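(* Let $m\ge 1$, $\varepsilon(1),\ldots,\varepsilon(m)\in\{-1,1\}$ and $f_1,\ldots,f_m\in\mathcal{R}^\infty([0,1])$. Then the limit $$\lim_{N\to\infty}\omega_\Omega\big(S_N^{\varepsilon(1)}(b,f_1)\cdots S_N^{\varepsilon(m)}(b,f_m)\big)$$ exists. It vanishes if $m$ is odd, and for $m=2n$ it is equal to $$\omega_\Omega\big(b^{\varepsilon(1)}(f_1)\cdots b^{\varepsilon(2n)}(f_{2n})\big).$$ Here $\omega_\Omega$ in the first display is the vacuum state on the discrete anti-monotone Fock space, and $\omega_\Omega$ in the second display is the vacuum state on the continuous anti-monotone Fock space over $[0,1]$.
   Context: $\mathcal{R}^\infty([0,1])$ denotes the set of bounded complex-valued Riemann integrable functions on $[0,1]$. Discrete anti-monotone Fock space. For $k\ge 1$ let $I_k^-$ be the set of strictly decreasing sequences $(i_1>i_2>\cdots>i_k)$ of natural numbers, and $I_0^-=\{\emptyset\}$. The discrete anti-monotone Fock space is $\mathcal{F}_m^-=\bigoplus_{k=0}^\infty \ell^2(I_k^-)$, with canonical orthonormal basis $e_\alpha$, and vacuum $\Omega=e_\emptyset$. For $i\in\mathbb{N}$ the creation operator is the bounded operator with $b_i^\dagger e_{(i_1,\ldots,i_k)}=e_{(i,i_1,\ldots,i_k)}$ if $i>i_1$ (or if $k=0$) and $0$ otherwise; the annihilation operator $b_i$ is its adjoint: $b_i e_{(i_1,\ldots,i_k)}=e_{(i_2,\ldots,i_k)}$ if $k\ge1$ and $i=i_1$, and $0$ otherwise. For $f\in\mathcal{R}^\infty([0,1])$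 and $N\ge 1$ set $$S_N^{1}(b,f)=\frac1{\sqrt N}\sum_{k=1}^N f\Big(\frac kN\Big)b_k^\dagger,\qquad S_N^{-1}(b,f)=\frac1{\sqrt N}\sum_{k=1}^N \overline{f\Big(\frac kN\Big)}\,b_k .$$ Continuous anti-monotone Fock space over $J=[0,1]$. For $n\ge 1$ let $J^n_-=\{(t_1,\ldots,t_n)\in[0,1]^n: t_1>\cdots>t_n\}$ and $\mathfrak{h}_n^-=L^2(J^n_-)$ with respect to Lebesgue measure, and $\mathfrak{h}_0^-=\mathbb{C}\Omega$, with $\Omega$ a unit vector (the vacuum). Set $\Gamma_m^-=\bigoplus_{n\ge0}\mathfrak{h}_n^-$ (Hilbert space direct sum; inner products are linear in the second variable). For $f\in L^2([0,1])$, the creation operator $b^\dagger(f)$ is the bounded operator mapping $\mathfrak{h}_n^-$ to $\mathfrak{h}_{n+1}^-$ by $[b^\dagger(f)g](t,t_1,\ldots,t_n)=f(t)g(t_1,\ldots,t_n)$ on $t>t_1>\cdots>t_n$ (and $b^\dagger(f)\Omega=f$); the annihilation operator $b(f)$ is its adjoint, so $b(f)\Omega=0$, $b(f)g=\big(\int_0^1\overline{f(t)}g(t)\,dt\big)\Omega$ for $g\in\mathfrak{h}_1^-$, and $[b(f)g](t_1,\ldots,t_n)=\int_{t>t_1}\overline{f(t)}g(t,t_1,\ldots,t_n)\,dt$ for $g\in\mathfrak{h}_{n+1}^-$, $n\ge1$. Write $b^1(f)=b^\dagger(f)$, $b^{-1}(f)=b(f)$. In either Fock space, $\omega_\Omega(X)=\langle\Omega,X\Omega\rangle$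 is the vacuum state. *)

theory Defs
  imports "HOL-Analysis.Analysis"
begin

section \<open>Bounded Riemann integrable functions on the unit interval\<close>

text \<open>
  The library integral is the gauge (Henstock--Kurzweil) integral, which integrates strictly more
  functions (also bounded ones).  Here the mesh of the tagged division is bounded uniformly.
  Functions on the unit interval are total functions whose values outside it are never used.
\<close>

definition riemann_integrable_01 :: "(real \<Rightarrow> complex) \<Rightarrow> bool" where
  "riemann_integrable_01 f \<longleftrightarrow>
     (\<exists>I. \<forall>e>0. \<exists>d>0. \<forall>p. p tagged_division_of {0..1} \<and> (\<forall>(x, K)\<in>p. diameter K < d) \<longrightarrow>
        norm ((\<Sum>(x, K)\<in>p. measure lborel K *\<^sub>R f x) - I) < e)"

definition riemann_bounded_01 :: "(real \<Rightarrow> complex) set" where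
  "riemann_bounded_01 = {f. bounded (f ` {0..1}) \<and> riemann_integrable_01 f}"


section \<open>Products of operators\<close>

definition op_prod :: "(nat \<Rightarrow> 'v \<Rightarrow> 'v) \<Rightarrow> nat \<Rightarrow> 'v \<Rightarrow> 'v" where
  "op_prod A m = foldr (\<lambda>j X. A j \<circ> X) [1..<Suc m] id"


section \<open>The discrete anti-monotone Fock space\<close>

text \<open>
  The direct sum over \<open>k\<close> of the spaces of square-summable functions on \<open>I_k\<close> is the space of
  square-summable functions on the set of all strictly decreasing finite sequences (of any length).
  Vectors are coefficient functions on lists, zero on lists that are not strictly decreasing.
\<close>

type_synonym dvec = "nat list \<Rightarrow> complex"

definition dseqs :: "nat list set" where
  "dseqs = {\<alpha>. sorted_wrt (>) \<alpha>}"

definition dfock :: "dvec set" where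
  "dfock = {\<psi>. (\<forall>\<alpha>. \<alpha> \<notin> dseqs \<longrightarrow> \<psi> \<alpha> = 0) \<and> (\<lambda>\<alpha>. (cmod (\<psi> \<alpha>))\<^sup>2) summable_on dseqs}"

definition d_inner :: "dvec \<Rightarrow> dvec \<Rightarrow> complex" where
  "d_inner \<phi> \<psi> = (\<Sum>\<^sub>\<infinity>\<alpha>\<in>dseqs. cnj (\<phi> \<alpha>) * \<psi> \<alpha>)"

definition d_basis :: "nat list \<Rightarrow> dvec" where
  "d_basis \<alpha> = (\<lambda>\<beta>. if \<beta> = \<alpha> then 1 else 0)"

definition d_vacuum :: dvec where
  "d_vacuum = d_basis []"

definition d_create :: "nat \<Rightarrow> dvec \<Rightarrow> dvec" where
  "d_create i \<psi> = (\<lambda>\<alpha>. case \<alpha> of [] \<Rightarrow> 0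
                       | j # \<beta> \<Rightarrow> if j = i \<and> j # \<beta> \<in> dseqs then \<psi> \<beta> else 0)"

definition d_annih :: "nat \<Rightarrow> dvec \<Rightarrow> dvec" where
  "d_annih i \<psi> = (\<lambda>\<beta>. if i # \<beta> \<in> dseqs then \<psi> (i # \<beta>) else 0)"

definition d_state :: "(dvec \<Rightarrow> dvec) \<Rightarrow> complex" where
  "d_state X = d_inner d_vacuum (X d_vacuum)"

definition S_op :: "nat \<Rightarrow> int \<Rightarrow> (real \<Rightarrow> complex) \<Rightarrow> dvec \<Rightarrow> dvec" where
  "S_op N \<epsilon> f \<psi> = (\<lambda>\<alpha>. (1 / complex_of_real (sqrt (real N))) *
     (if \<epsilon> = 1 then (\<Sum>k=1..N. f (real k / real N) * d_create k \<psi> \<alpha>)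
      else (\<Sum>k=1..N. cnj (f (real k / real N)) * d_annih k \<psi> \<alpha>)))"


section \<open>The continuous anti-monotone Fock space over the unit interval\<close>

text \<open>
  Coordinates are numbered from \<open>0\<close>: \<open>t 0 > t 1 > \<dots> > t (n - 1)\<close>.  For \<open>n = 0\<close> the measure is the
  unit mass at a single point, so its square-integrable functions form a copy of the complex numbers.
  The product of the completed measures is not itself complete, but its completion has the same
  space of square-integrable functions modulo null sets.

  Vectors are sequences of representatives: the \<open>n\<close>-th entry of a vector represents its component
  in the \<open>n\<close>-particle space, and two sequences represent the same vector iff they are related
  by \<open>c_eq\<close>.
\<close>

type_synonym cvec = "nat \<Rightarrow> (nat \<Rightarrow> real) \<Rightarrow> complex"

definition simplex_measure :: "nat \<Rightarrow> (nat \<Rightarrow> real) measure" where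
  "simplex_measure n = restrict_space (Pi\<^sub>M {..<n} (\<lambda>_. lebesgue_on {0..1}))
                         {t. \<forall>j<n. \<forall>i<j. t i > t j}"

definition L2 :: "'a measure \<Rightarrow> ('a \<Rightarrow> complex) set" where
  "L2 M = {g \<in> borel_measurable M. integrable M (\<lambda>x. (cmod (g x))\<^sup>2)}"

definition cfock :: "cvec set" where
  "cfock = {\<psi>. (\<forall>n. \<psi> n \<in> L2 (simplex_measure n)) \<and>
               summable (\<lambda>n. LINT t|simplex_measure n. (cmod (\<psi> n t))\<^sup>2)}"

definition c_eq :: "cvec \<Rightarrow> cvec \<Rightarrow> bool" where
  "c_eq \<phi> \<psi> \<longleftrightarrow> (\<forall>n. AE t in simplex_measure n. \<phi> n t = \<psi> n t)"

definition c_inner :: "cvec \<Rightarrow> cvec \<Rightarrow> complex" where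
  "c_inner \<phi> \<psi> = (\<Sum>n. LINT t|simplex_measure n. cnj (\<phi> n t) * \<psi> n t)"

definition c_vacuum :: cvec where
  "c_vacuum = (\<lambda>n t. if n = 0 then 1 else 0)"

definition tup_tail :: "nat \<Rightarrow> (nat \<Rightarrow> real) \<Rightarrow> nat \<Rightarrow> real" where
  "tup_tail n t = (\<lambda>i\<in>{..<n}. t (Suc i))"

definition tup_cons :: "nat \<Rightarrow> real \<Rightarrow> (nat \<Rightarrow> real) \<Rightarrow> nat \<Rightarrow> real" where
  "tup_cons n s t = (\<lambda>i\<in>{..<Suc n}. case i of 0 \<Rightarrow> s | Suc j \<Rightarrow> t j)"

definition c_create :: "(real \<Rightarrow> complex) \<Rightarrow> cvec \<Rightarrow> cvec" where
  "c_create f \<psi> = (\<lambda>n t. case n of 0 \<Rightarrow> 0 | Suc k \<Rightarrow> f (t 0) * \<psi> k (tup_tail k t))"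

definition c_annih :: "(real \<Rightarrow> complex) \<Rightarrow> cvec \<Rightarrow> cvec" where
  "c_annih f \<psi> = (\<lambda>n t. LINT s|lebesgue_on {s \<in> {0..1}. n \<ge> 1 \<longrightarrow> s > t 0}.
                            cnj (f s) * \<psi> (Suc n) (tup_cons n s t))"

definition c_state :: "(cvec \<Rightarrow> cvec) \<Rightarrow> complex" where
  "c_state X = c_inner c_vacuum (X c_vacuum)"

definition b_op :: "int \<Rightarrow> (real \<Rightarrow> complex) \<Rightarrow> cvec \<Rightarrow> cvec" where
  "b_op \<epsilon> f = (if \<epsilon> = 1 then c_create f else c_annih f)"


section \<open>The formulas above define mutually adjoint operators on the Fock spaces\<close>

text \<open>
  For both spaces: creation and annihilation map the Fock space to itself and are adjoint to each
  other; for the continuous one they also respect \<open>c_eq\<close>, so they act on equivalence classes.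
\<close>

lemma riemann_bounded_01_L2:
  assumes "f \<in> riemann_bounded_01"
  shows "f \<in> L2 (lebesgue_on {0..1})"
proof -
  obtain I where I: "\<And>e. e > 0 \<Longrightarrow> \<exists>d>0. \<forall>p. p tagged_division_of {0..1} \<and>
      (\<forall>(x, K)\<in>p. diameter K < d) \<longrightarrow> norm ((\<Sum>(x, K)\<in>p. measure lborel K *\<^sub>R f x) - I) < e"
    using assms unfolding riemann_bounded_01_def riemann_integrable_01_def by blast
  have "(f has_integral I) {0..1}"
    unfolding has_integral_real
  proof (intro allI impI)
    fix e :: real assume "e > 0"
    then obtain d where d: "d > 0" "\<And>p. p tagged_division_of {0..1} \<Longrightarrow>
      (\<forall>(x, K)\<in>p. diameter K < d) \<Longrightarrow> norm ((\<Sum>(x, K)\<in>p. measure lborel K *\<^sub>R f x) - I) < e"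
      using I[OF \<open>e > 0\<close>] by blast
    have "diameter K < d" if "K \<subseteq> ball x (d / 3)" for K and x :: real
    proof -
      have "diameter K \<le> diameter (ball x (d / 3))"
        using that by (rule diameter_subset) (rule bounded_ball)
      also have "\<dots> < d" using d(1) by simp
      finally show ?thesis .
    qed
    then have *: "\<forall>(x, K)\<in>p. diameter K < d" if "(\<lambda>x. ball x (d / 3)) fine p" for p :: "(real \<times> real set) set"
      using fineD[OF that] by blast
    show "\<exists>\<gamma>. gauge \<gamma> \<and> (\<forall>\<D>. \<D> tagged_division_of {0..1} \<and> \<gamma> fine \<D> \<longrightarrow>
        norm ((\<Sum>(x, K)\<in>\<D>. measure lborel K *\<^sub>R f x) - I) < e)"
    proof (intro exI[of _ "\<lambda>x. ball x (d / 3)"] conjI allI impI)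
      show "gauge (\<lambda>x::real. ball x (d / 3))" using d(1) by (intro gauge_ball) simp
    next
      fix p :: "(real \<times> real set) set"
      assume "p tagged_division_of {0..1} \<and> (\<lambda>x. ball x (d / 3)) fine p"
      then show "norm ((\<Sum>(x, K)\<in>p. measure lborel K *\<^sub>R f x) - I) < e"
        using d(2)[OF _ *] by blast
    qed
  qed
  then have m: "f \<in> borel_measurable (lebesgue_on {0..1})"
    by (rule integrable_imp_measurable[OF has_integral_integrable])
  obtain B where "\<forall>x\<in>{0..1}. norm (f x) \<le> B"
    using assms unfolding riemann_bounded_01_def bounded_iff by blast
  then have "norm ((norm (f x))\<^sup>2) \<le> B\<^sup>2" if "x \<in> {0..1}" for x
    using that by (auto intro!: power_mono)
  then have b: "AE x in lebesgue_on {0..1}. norm ((norm (f x))\<^sup>2) \<le> B\<^sup>2"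
    by (intro AE_I2) (simp only: space_lebesgue_on)
  have "(\<lambda>x. (norm (f x))\<^sup>2) \<in> borel_measurable (lebesgue_on {0..1})"
    using m by measurable
  then have "integrable (lebesgue_on {0..1}) (\<lambda>x. (norm (f x))\<^sup>2)"
    by (intro finite_measure.integrable_const_bound[OF _ b] finite_measure_lebesgue_on) simp_all
  with m show ?thesis
    unfolding L2_def by blast
qed

lemma d_create_basis:
  assumes "\<alpha> \<in> dseqs"
  shows "d_create i (d_basis \<alpha>) = (if \<alpha> = [] \<or> i > hd \<alpha> then d_basis (i # \<alpha>) else (\<lambda>_. 0))"
proof
  fix \<beta>
  show "d_create i (d_basis \<alpha>) \<beta> = (if \<alpha> = [] \<or> i > hd \<alpha> then d_basis (i # \<alpha>) else (\<lambda>_. 0)) \<beta>"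
    using assms
    by (cases \<beta>; cases \<alpha>) (auto simp: d_create_def d_basis_def dseqs_def)
qed

lemma d_annih_basis:
  assumes "\<alpha> \<in> dseqs"
  shows "d_annih i (d_basis \<alpha>) = (if \<alpha> \<noteq> [] \<and> i = hd \<alpha> then d_basis (tl \<alpha>) else (\<lambda>_. 0))"
  using assms
  by (cases \<alpha>) (auto simp: d_annih_def d_basis_def dseqs_def fun_eq_iff)

lemma d_reindex: "(\<lambda>\<alpha>. i # \<alpha>) ` {\<beta>. i # \<beta> \<in> dseqs} \<subseteq> dseqs" "{\<beta>. i # \<beta> \<in> dseqs} \<subseteq> dseqs"
  by (auto simp: dseqs_def)

lemma d_create_dfock:
  assumes "\<psi> \<in> dfock"
  shows "d_create i \<psi> \<in> dfock"
proof -
  have "(\<lambda>\<alpha>. (cmod (\<psi> \<alpha>))\<^sup>2) summable_on {\<beta>. i # \<beta> \<in> dseqs}"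
    using assms d_reindex(2) by (auto simp: dfock_def intro: summable_on_subset_banach)
  then have "((\<lambda>\<alpha>. (cmod (d_create i \<psi> \<alpha>))\<^sup>2) \<circ> (\<lambda>\<alpha>. i # \<alpha>)) summable_on {\<beta>. i # \<beta> \<in> dseqs}"
    by (rule summable_on_cong[THEN iffD1, rotated]) (auto simp: d_create_def)
  then have "(\<lambda>\<alpha>. (cmod (d_create i \<psi> \<alpha>))\<^sup>2) summable_on ((\<lambda>\<alpha>. i # \<alpha>) ` {\<beta>. i # \<beta> \<in> dseqs})"
    by (subst summable_on_reindex) (auto simp: inj_on_def)
  then have "(\<lambda>\<alpha>. (cmod (d_create i \<psi> \<alpha>))\<^sup>2) summable_on dseqs"
    by (rule summable_on_cong_neutral[THEN iffD1, rotated 3])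
       (use d_reindex(1) in \<open>auto simp: d_create_def split: list.splits\<close>)
  then show ?thesis
    by (auto simp: dfock_def d_create_def split: list.splits)
qed

lemma d_annih_dfock:
  assumes "\<psi> \<in> dfock"
  shows "d_annih i \<psi> \<in> dfock"
proof -
  have "(\<lambda>\<alpha>. (cmod (\<psi> \<alpha>))\<^sup>2) summable_on ((\<lambda>\<alpha>. i # \<alpha>) ` {\<beta>. i # \<beta> \<in> dseqs})"
    using assms d_reindex(1) by (auto simp: dfock_def intro: summable_on_subset_banach)
  then have "((\<lambda>\<alpha>. (cmod (\<psi> \<alpha>))\<^sup>2) \<circ> (\<lambda>\<alpha>. i # \<alpha>)) summable_on {\<beta>. i # \<beta> \<in> dseqs}"
    by (subst (asm) summable_on_reindex) (auto simp: inj_on_def)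
  then have "(\<lambda>\<alpha>. (cmod (d_annih i \<psi> \<alpha>))\<^sup>2) summable_on dseqs"
    by (rule summable_on_cong_neutral[THEN iffD1, rotated 3])
       (use d_reindex in \<open>auto simp: d_annih_def\<close>)
  then show ?thesis
    by (auto simp: dfock_def d_annih_def dseqs_def)
qed

lemma d_adjoint: "d_inner (d_create i \<phi>) \<psi> = d_inner \<phi> (d_annih i \<psi>)"
proof -
  have "d_inner (d_create i \<phi>) \<psi> =
      (\<Sum>\<^sub>\<infinity>\<alpha>\<in>(\<lambda>\<alpha>. i # \<alpha>) ` {\<beta>. i # \<beta> \<in> dseqs}. cnj (d_create i \<phi> \<alpha>) * \<psi> \<alpha>)"
    unfolding d_inner_def
    by (rule infsum_cong_neutral) (auto simp: d_create_def split: list.splits if_splits)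
  also have "\<dots> = (\<Sum>\<^sub>\<infinity>\<beta>\<in>{\<beta>. i # \<beta> \<in> dseqs}. cnj (\<phi> \<beta>) * d_annih i \<psi> \<beta>)"
    by (subst infsum_reindex) (auto simp: inj_on_def d_create_def d_annih_def intro!: infsum_cong)
  also have "\<dots> = d_inner \<phi> (d_annih i \<psi>)"
    unfolding d_inner_def
    by (rule infsum_cong_neutral) (use d_reindex in \<open>auto simp: d_annih_def\<close>)
  finally show ?thesis .
qed


abbreviation I1 :: "real measure" where "I1 \<equiv> lebesgue_on {0..1}"

abbreviation cube :: "nat \<Rightarrow> (nat \<Rightarrow> real) measure" where "cube n \<equiv> Pi\<^sub>M {..<n} (\<lambda>_. I1)"

abbreviation newpts :: "nat \<Rightarrow> (nat \<Rightarrow> real) \<Rightarrow> real set" where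
  "newpts n t \<equiv> {s \<in> {0..1}. n \<ge> 1 \<longrightarrow> s > t 0}"

interpretation I1: finite_measure I1
  by (rule finite_measure_lebesgue_on) auto

interpretation I1_prod: product_sigma_finite "\<lambda>_::nat. I1"
  by standard

interpretation cube: sigma_finite_measure "cube n" for n
  by (rule I1_prod.sigma_finite) auto

interpretation I1_cube: pair_sigma_finite I1 "cube n" for n
  by standard

interpretation cube_I1: pair_sigma_finite "cube n" I1 for n
  by standard

lemma space_I1: "space I1 = {0..1}"
  by simp

lemma measurable_I1_borel [measurable]: "(\<lambda>x. x) \<in> borel_measurable I1"
  by (intro measurable_restrict_space1 measurable_completion) auto

lemma coord_measurable [measurable]: "i < n \<Longrightarrow> (\<lambda>t. t i) \<in> borel_measurable (cube n)"
  by (rule measurable_compose[OF measurable_component_singleton[where M = "\<lambda>_. I1"] measurable_I1_borel]) auto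

definition dset :: "nat \<Rightarrow> (nat \<Rightarrow> real) set" where
  "dset n = {t \<in> space (cube n). \<forall>j<n. \<forall>i<j. t i > t j}"

lemma dset_sets [measurable]: "dset n \<in> sets (cube n)"
proof -
  have "Measurable.pred (cube n) (\<lambda>t. \<forall>j\<in>{..<n}. \<forall>i\<in>{..<j}. t i > t j)"
    by (intro pred_intros_finite borel_measurable_pred_less coord_measurable) auto
  then show ?thesis
    unfolding dset_def by (simp add: pred_def Ball_def)
qed

lemma simplex_measure_alt: "simplex_measure n = restrict_space (cube n) (dset n)"
proof -
  define A :: "(nat \<Rightarrow> real) set" where "A = {t. \<forall>j<n. \<forall>i<j. t i > t j}"
  have D: "dset n = space (cube n) \<inter> A"
    unfolding dset_def A_def by blast
  have "(\<inter>) (space (cube n) \<inter> A) ` sets (cube n) = (\<inter>) A ` sets (cube n)"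
    by (rule image_cong[OF refl]) (use sets.sets_into_space in blast)
  then show ?thesis
    unfolding simplex_measure_def A_def[symmetric] D restrict_space_def
    by (simp only: Int_ac Int_absorb Int_left_absorb)
qed

lemma space_simplex: "space (simplex_measure n) = dset n"
  unfolding simplex_measure_alt space_restrict_space using sets.sets_into_space[OF dset_sets] by auto

lemma tup_cons_measurable [measurable]:
  "(\<lambda>(s, t). tup_cons n s t) \<in> I1 \<Otimes>\<^sub>M cube n \<rightarrow>\<^sub>M cube (Suc n)"
  unfolding tup_cons_def split_beta
proof (rule measurable_restrict)
  fix i assume "i \<in> {..<Suc n}"
  then show "(\<lambda>x. case i of 0 \<Rightarrow> fst x | Suc j \<Rightarrow> snd x j) \<in> I1 \<Otimes>\<^sub>M cube n \<rightarrow>\<^sub>M I1"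
    by (cases i) (auto intro!: measurable_compose[OF measurable_snd measurable_component_singleton])
qed

lemma cube_Suc: "cube (Suc n) = distr (I1 \<Otimes>\<^sub>M cube n) (cube (Suc n)) (\<lambda>(s, t). tup_cons n s t)"
proof (rule I1_prod.PiM_eqI[symmetric])
  fix A :: "nat \<Rightarrow> real set" assume A: "\<And>i. i \<in> {..<Suc n} \<Longrightarrow> A i \<in> sets I1"
  have *: "(\<lambda>(s, t). tup_cons n s t) -` Pi\<^sub>E {..<Suc n} A \<inter> space (I1 \<Otimes>\<^sub>M cube n) =
     A 0 \<times> Pi\<^sub>E {..<n} (\<lambda>i. A (Suc i))"
  proof (intro set_eqI iffI)
    fix x assume x: "x \<in> A 0 \<times> Pi\<^sub>E {..<n} (\<lambda>i. A (Suc i))"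
    obtain s u where su: "x = (s, u)" "s \<in> A 0" "u \<in> Pi\<^sub>E {..<n} (\<lambda>i. A (Suc i))"
      using x by blast
    have A01: "A i \<subseteq> {0..1}" if "i < Suc n" for i
      using sets.sets_into_space[OF A, of i] that by (simp only: space_I1 lessThan_iff)
    have "tup_cons n s u \<in> Pi\<^sub>E {..<Suc n} A"
      unfolding tup_cons_def
    proof (rule restrict_PiE_iff[THEN iffD2], rule ballI)
      fix i assume "i \<in> {..<Suc n}"
      then show "(case i of 0 \<Rightarrow> s | Suc j \<Rightarrow> u j) \<in> A i"
        using su(2) PiE_mem[OF su(3)] by (cases i) simp_all
    qed
    moreover have "u \<in> Pi\<^sub>E {..<n} (\<lambda>i. {0..1})"
      by (rule set_mp[OF PiE_mono su(3)]) (simp add: A01)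
    moreover have "s \<in> {0..1}" using A01[of 0] su(2) by blast
    ultimately show "x \<in> (\<lambda>(s, t). tup_cons n s t) -` Pi\<^sub>E {..<Suc n} A \<inter> space (I1 \<Otimes>\<^sub>M cube n)"
      by (simp add: su(1) space_pair_measure space_PiM)
  next
    fix x assume "x \<in> (\<lambda>(s, t). tup_cons n s t) -` Pi\<^sub>E {..<Suc n} A \<inter> space (I1 \<Otimes>\<^sub>M cube n)"
    then have x: "tup_cons n (fst x) (snd x) \<in> Pi\<^sub>E {..<Suc n} A" "snd x \<in> extensional {..<n}"
      by (simp_all add: space_pair_measure space_PiM PiE_def split_beta mem_Times_iff)
    have "fst x \<in> A 0" using x(1)[THEN PiE_mem, of 0] by (simp add: tup_cons_def)
    moreover have "snd x i \<in> A (Suc i)" if "i < n" for i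
      using x(1)[THEN PiE_mem, of "Suc i"] that by (simp add: tup_cons_def)
    ultimately show "x \<in> A 0 \<times> Pi\<^sub>E {..<n} (\<lambda>i. A (Suc i))"
      using x(2) by (simp add: mem_Times_iff PiE_iff)
  qed
  have P: "Pi\<^sub>E {..<Suc n} A \<in> sets (cube (Suc n))"
    by (rule sets_PiM_I_finite) (simp_all only: A finite_lessThan)
  have P': "Pi\<^sub>E {..<n} (\<lambda>i. A (Suc i)) \<in> sets (cube n)"
    by (rule sets_PiM_I_finite) (simp_all add: A)
  have "emeasure (distr (I1 \<Otimes>\<^sub>M cube n) (cube (Suc n)) (\<lambda>(s, t). tup_cons n s t)) (Pi\<^sub>E {..<Suc n} A) =
      emeasure (I1 \<Otimes>\<^sub>M cube n) (A 0 \<times> Pi\<^sub>E {..<n} (\<lambda>i. A (Suc i)))"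
    unfolding emeasure_distr[OF tup_cons_measurable P] * ..
  also have "\<dots> = emeasure I1 (A 0) * emeasure (cube n) (Pi\<^sub>E {..<n} (\<lambda>i. A (Suc i)))"
    by (rule cube.emeasure_pair_measure_Times[OF _ P']) (simp add: A)
  also have "emeasure (cube n) (Pi\<^sub>E {..<n} (\<lambda>i. A (Suc i))) = (\<Prod>i<n. emeasure I1 (A (Suc i)))"
    by (rule I1_prod.emeasure_PiM) (simp_all add: A)
  also have "emeasure I1 (A 0) * (\<Prod>i<n. emeasure I1 (A (Suc i))) = (\<Prod>i<Suc n. emeasure I1 (A i))"
    by (subst prod.lessThan_Suc_shift) (rule refl)
  finally show "emeasure (distr (I1 \<Otimes>\<^sub>M cube n) (cube (Suc n)) (\<lambda>(s, t). tup_cons n s t)) (Pi\<^sub>E {..<Suc n} A) =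
      (\<Prod>i<Suc n. emeasure I1 (A i))" .
qed simp_all

lemma tup_cons_dset:
  assumes "s \<in> {0..1}" "t \<in> space (cube n)"
  shows "tup_cons n s t \<in> dset (Suc n) \<longleftrightarrow> t \<in> dset n \<and> s \<in> newpts n t"
proof -
  have "tup_cons n s t \<in> space (cube (Suc n))"
    using measurable_space[OF tup_cons_measurable, of "(s, t)" n] assms by (simp add: space_pair_measure)
  moreover have "(\<forall>j<Suc n. \<forall>i<j. tup_cons n s t i > tup_cons n s t j) \<longleftrightarrow>
       (\<forall>j<n. \<forall>i<j. t i > t j) \<and> (n \<ge> 1 \<longrightarrow> s > t 0)" (is "?L \<longleftrightarrow> ?R")
  proof
    assume L: ?L
    have "t i > t j" if "j < n" "i < j" for i j
      using L[rule_format, of "Suc j" "Suc i"] that by (simp add: tup_cons_def)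
    moreover have "s > t 0" if "n \<ge> 1"
      using L[rule_format, of 1 0] that by (simp add: tup_cons_def)
    ultimately show ?R by auto
  next
    assume R: ?R
    have "tup_cons n s t i > tup_cons n s t j" if "j < Suc n" "i < j" for i j
    proof -
      from that obtain j' where j': "j = Suc j'" by (cases j) auto
      have "s > t j'" using R that j' by (cases "j' = 0") (auto intro: order.strict_trans)
      then show ?thesis using that R j' by (cases i) (auto simp: tup_cons_def)
    qed
    then show ?L by auto
  qed
  ultimately show ?thesis
    using assms unfolding dset_def by auto
qed

lemma tup_tail_cons: "t \<in> space (cube n) \<Longrightarrow> tup_tail n (tup_cons n s t) = t"
  by (auto simp: tup_tail_def tup_cons_def space_PiM PiE_iff extensional_def fun_eq_iff)

lemma tup_cons_0: "tup_cons n s t 0 = s"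
  by (simp add: tup_cons_def)

lemma newpts_sets: "newpts n t \<in> sets lebesgue"
proof -
  have "newpts n t = (if n \<ge> 1 then {0..1} \<inter> {t 0<..} else {0..1})" by auto
  then show ?thesis by auto
qed

text \<open>Fubini's theorem on the simplex, splitting off the first (largest) coordinate.\<close>

lemma newpts_integral:
  fixes g :: "real \<Rightarrow> 'b::{banach, second_countable_topology}"
  shows "(LINT s|lebesgue_on (newpts n t). g s) = (LINT s|I1. indicator (newpts n t) s *\<^sub>R g s)"
proof -
  have "lebesgue_on (newpts n t) = restrict_space I1 (newpts n t)"
    by (subst restrict_restrict_space) (auto simp: newpts_sets intro!: arg_cong2[where f = restrict_space])
  then show ?thesis
    using newpts_sets[of n t] by (simp add: integral_restrict_space sets_restrict_space_iff)
qed

lemma newpts_nn_integral: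
  "(\<integral>\<^sup>+s. g s \<partial>lebesgue_on (newpts n t)) = (\<integral>\<^sup>+s. g s * indicator (newpts n t) s \<partial>I1)"
proof -
  have "lebesgue_on (newpts n t) = restrict_space I1 (newpts n t)"
    by (subst restrict_restrict_space) (auto simp: newpts_sets intro!: arg_cong2[where f = restrict_space])
  then show ?thesis
    using newpts_sets[of n t] by (simp add: nn_integral_restrict_space sets_restrict_space_iff)
qed

lemma simplex_nn_integral:
  assumes F: "F \<in> borel_measurable (simplex_measure (Suc n))"
  shows "(\<integral>\<^sup>+u. F u \<partial>simplex_measure (Suc n)) =
         (\<integral>\<^sup>+t. (\<integral>\<^sup>+s. F (tup_cons n s t) \<partial>lebesgue_on (newpts n t)) \<partial>simplex_measure n)"
proof -
  have [measurable]: "(\<lambda>u. F u * indicator (dset (Suc n)) u) \<in> borel_measurable (cube (Suc n))"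
    using F unfolding simplex_measure_alt by (subst (asm) borel_measurable_restrict_space_iff_ennreal) auto
  have "(\<integral>\<^sup>+u. F u \<partial>simplex_measure (Suc n)) = (\<integral>\<^sup>+u. F u * indicator (dset (Suc n)) u \<partial>cube (Suc n))"
    unfolding simplex_measure_alt by (subst nn_integral_restrict_space) auto
  also have "\<dots> = (\<integral>\<^sup>+(s, t). F (tup_cons n s t) * indicator (dset (Suc n)) (tup_cons n s t) \<partial>(I1 \<Otimes>\<^sub>M cube n))"
    by (subst cube_Suc, subst nn_integral_distr) (auto simp: case_prod_unfold)
  also have "\<dots> = (\<integral>\<^sup>+t. \<integral>\<^sup>+s. F (tup_cons n s t) * indicator (dset (Suc n)) (tup_cons n s t) \<partial>I1 \<partial>cube n)"
    by (subst I1_cube.nn_integral_snd[symmetric]) (auto simp: case_prod_unfold)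
  also have "\<dots> = (\<integral>\<^sup>+t. (\<integral>\<^sup>+s. F (tup_cons n s t) * indicator (newpts n t) s \<partial>I1) * indicator (dset n) t \<partial>cube n)"
  proof (rule nn_integral_cong)
    fix t assume t: "t \<in> space (cube n)"
    then have "(\<integral>\<^sup>+s. F (tup_cons n s t) * indicator (dset (Suc n)) (tup_cons n s t) \<partial>I1) =
        (\<integral>\<^sup>+s. F (tup_cons n s t) * indicator (newpts n t) s * indicator (dset n) t \<partial>I1)"
      by (intro nn_integral_cong) (auto simp: indicator_def tup_cons_dset)
    also have "\<dots> = (\<integral>\<^sup>+s. F (tup_cons n s t) * indicator (newpts n t) s \<partial>I1) * indicator (dset n) t"
      by (cases "t \<in> dset n") simp_all
    finally show "(\<integral>\<^sup>+s. F (tup_cons n s t) * indicator (dset (Suc n)) (tup_cons n s t) \<partial>I1) =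
        (\<integral>\<^sup>+s. F (tup_cons n s t) * indicator (newpts n t) s \<partial>I1) * indicator (dset n) t" .
  qed
  also have "\<dots> = (\<integral>\<^sup>+t. (\<integral>\<^sup>+s. F (tup_cons n s t) \<partial>lebesgue_on (newpts n t)) \<partial>simplex_measure n)"
    unfolding simplex_measure_alt newpts_nn_integral by (subst nn_integral_restrict_space) auto
  finally show ?thesis .
qed

lemma simplex_integral:
  fixes F :: "(nat \<Rightarrow> real) \<Rightarrow> complex"
  assumes F: "integrable (simplex_measure (Suc n)) F"
  shows "(LINT u|simplex_measure (Suc n). F u) =
         (LINT t|simplex_measure n. LINT s|lebesgue_on (newpts n t). F (tup_cons n s t))"
proof -
  have i: "integrable (cube (Suc n)) (\<lambda>u. indicator (dset (Suc n)) u *\<^sub>R F u)"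
    using F unfolding simplex_measure_alt by (subst (asm) integrable_restrict_space) auto
  then have i': "integrable (I1 \<Otimes>\<^sub>M cube n)
     (\<lambda>(s, t). indicator (dset (Suc n)) (tup_cons n s t) *\<^sub>R F (tup_cons n s t))"
    by (subst (asm) cube_Suc, subst (asm) integrable_distr_eq) (auto simp: case_prod_unfold)
  have "(LINT u|simplex_measure (Suc n). F u) = (LINT u|cube (Suc n). indicator (dset (Suc n)) u *\<^sub>R F u)"
    unfolding simplex_measure_alt by (subst integral_restrict_space) auto
  also have "\<dots> = (LINT x|(I1 \<Otimes>\<^sub>M cube n). (case x of (s, t) \<Rightarrow>
       indicator (dset (Suc n)) (tup_cons n s t) *\<^sub>R F (tup_cons n s t)))"
    using i by (subst cube_Suc, subst integral_distr) (auto simp: case_prod_unfold)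
  also have "\<dots> = (LINT t|cube n. LINT s|I1. indicator (dset (Suc n)) (tup_cons n s t) *\<^sub>R F (tup_cons n s t))"
    using I1_cube.integral_snd[OF i'] by simp
  also have "\<dots> = (LINT t|cube n. indicator (dset n) t *\<^sub>R (LINT s|I1. indicator (newpts n t) s *\<^sub>R F (tup_cons n s t)))"
  proof (rule Bochner_Integration.integral_cong[OF refl])
    fix t assume t: "t \<in> space (cube n)"
    then have "(LINT s|I1. indicator (dset (Suc n)) (tup_cons n s t) *\<^sub>R F (tup_cons n s t)) =
        (LINT s|I1. indicator (dset n) t *\<^sub>R (indicator (newpts n t) s *\<^sub>R F (tup_cons n s t)))"
      by (intro Bochner_Integration.integral_cong) (auto simp: indicator_def tup_cons_dset)
    then show "(LINT s|I1. indicator (dset (Suc n)) (tup_cons n s t) *\<^sub>R F (tup_cons n s t)) =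
        indicator (dset n) t *\<^sub>R (LINT s|I1. indicator (newpts n t) s *\<^sub>R F (tup_cons n s t))"
      by (simp only: Bochner_Integration.integral_scaleR_right)
  qed
  also have "\<dots> = (LINT t|simplex_measure n. LINT s|lebesgue_on (newpts n t). F (tup_cons n s t))"
    unfolding simplex_measure_alt newpts_integral by (subst integral_restrict_space) auto
  finally show ?thesis .
qed

lemma simplex_integral_measurable:
  fixes F :: "(nat \<Rightarrow> real) \<Rightarrow> complex"
  assumes F: "F \<in> borel_measurable (simplex_measure (Suc n))"
  shows "(\<lambda>t. LINT s|lebesgue_on (newpts n t). F (tup_cons n s t)) \<in> borel_measurable (simplex_measure n)"
proof -
  have [measurable]: "(\<lambda>u. indicator (dset (Suc n)) u *\<^sub>R F u) \<in> borel_measurable (cube (Suc n))"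
    using F unfolding simplex_measure_alt by (subst (asm) borel_measurable_restrict_space_iff) auto
  have m: "(\<lambda>t. LINT s|I1. indicator (dset (Suc n)) (tup_cons n s t) *\<^sub>R F (tup_cons n s t)) \<in> borel_measurable (cube n)"
  proof (rule I1.borel_measurable_lebesgue_integral)
    have "(\<lambda>(s, t). indicator (dset (Suc n)) (tup_cons n s t) *\<^sub>R F (tup_cons n s t))
        \<in> borel_measurable (I1 \<Otimes>\<^sub>M cube n)"
      using measurable_compose[OF tup_cons_measurable, of "\<lambda>u. indicator (dset (Suc n)) u *\<^sub>R F u"]
      by (simp add: case_prod_unfold)
    then show "(\<lambda>(t, s). indicator (dset (Suc n)) (tup_cons n s t) *\<^sub>R F (tup_cons n s t))
        \<in> borel_measurable (cube n \<Otimes>\<^sub>M I1)"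
      by (rule measurable_pair_swap[THEN measurable_cong[THEN iffD1, rotated]]) (simp add: case_prod_unfold)
  qed
  show ?thesis
  proof (rule measurable_cong[THEN iffD2])
    fix t assume "t \<in> space (simplex_measure n)"
    then have t: "t \<in> dset n" "t \<in> space (cube n)" by (auto simp: space_simplex dset_def)
    show "(LINT s|lebesgue_on (newpts n t). F (tup_cons n s t)) =
       (LINT s|I1. indicator (dset (Suc n)) (tup_cons n s t) *\<^sub>R F (tup_cons n s t))"
      unfolding newpts_integral
      using t by (auto intro!: Bochner_Integration.integral_cong simp: indicator_def tup_cons_dset)
  next
    show "(\<lambda>t. LINT s|I1. indicator (dset (Suc n)) (tup_cons n s t) *\<^sub>R F (tup_cons n s t))
       \<in> borel_measurable (simplex_measure n)"
      unfolding simplex_measure_alt using m by (rule measurable_restrict_space1)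
  qed
qed

lemma simplex_nn_integral_measurable:
  assumes F: "F \<in> borel_measurable (simplex_measure (Suc n))"
  shows "(\<lambda>t. \<integral>\<^sup>+s. F (tup_cons n s t) \<partial>lebesgue_on (newpts n t)) \<in> borel_measurable (simplex_measure n)"
proof -
  have [measurable]: "(\<lambda>u. F u * indicator (dset (Suc n)) u) \<in> borel_measurable (cube (Suc n))"
    using F unfolding simplex_measure_alt by (subst (asm) borel_measurable_restrict_space_iff_ennreal) auto
  have m: "(\<lambda>t. \<integral>\<^sup>+s. F (tup_cons n s t) * indicator (dset (Suc n)) (tup_cons n s t) \<partial>I1) \<in> borel_measurable (cube n)"
  proof (rule I1.borel_measurable_nn_integral)
    have "(\<lambda>(s, t). F (tup_cons n s t) * indicator (dset (Suc n)) (tup_cons n s t))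
        \<in> borel_measurable (I1 \<Otimes>\<^sub>M cube n)"
      using measurable_compose[OF tup_cons_measurable, of "\<lambda>u. F u * indicator (dset (Suc n)) u"]
      by (simp add: case_prod_unfold)
    then show "(\<lambda>(t, s). F (tup_cons n s t) * indicator (dset (Suc n)) (tup_cons n s t))
        \<in> borel_measurable (cube n \<Otimes>\<^sub>M I1)"
      by (rule measurable_pair_swap[THEN measurable_cong[THEN iffD1, rotated]]) (simp add: case_prod_unfold)
  qed
  show ?thesis
  proof (rule measurable_cong[THEN iffD2])
    fix t assume "t \<in> space (simplex_measure n)"
    then have t: "t \<in> dset n" "t \<in> space (cube n)" by (auto simp: space_simplex dset_def)
    show "(\<integral>\<^sup>+s. F (tup_cons n s t) \<partial>lebesgue_on (newpts n t)) =
       (\<integral>\<^sup>+s. F (tup_cons n s t) * indicator (dset (Suc n)) (tup_cons n s t) \<partial>I1)"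
      unfolding newpts_nn_integral
      using t by (auto intro!: nn_integral_cong simp: indicator_def tup_cons_dset)
  next
    show "(\<lambda>t. \<integral>\<^sup>+s. F (tup_cons n s t) * indicator (dset (Suc n)) (tup_cons n s t) \<partial>I1)
       \<in> borel_measurable (simplex_measure n)"
      unfolding simplex_measure_alt using m by (rule measurable_restrict_space1)
  qed
qed

lemma section_measurable:
  assumes t: "t \<in> dset n"
  shows "(\<lambda>s. tup_cons n s t) \<in> lebesgue_on (newpts n t) \<rightarrow>\<^sub>M simplex_measure (Suc n)"
  unfolding simplex_measure_alt
proof (rule measurable_restrict_space2)
  have ts: "t \<in> space (cube n)" using t by (auto simp: dset_def)
  show "(\<lambda>s. tup_cons n s t) \<in> space (lebesgue_on (newpts n t)) \<rightarrow> dset (Suc n)"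
    using t ts by (auto simp: tup_cons_dset)
  have "(\<lambda>s. tup_cons n s t) \<in> I1 \<rightarrow>\<^sub>M cube (Suc n)"
    using measurable_compose[OF measurable_Pair2'[OF ts] tup_cons_measurable] by simp
  then have "(\<lambda>s. tup_cons n s t) \<in> restrict_space I1 (newpts n t) \<rightarrow>\<^sub>M cube (Suc n)"
    by (rule measurable_restrict_space1)
  moreover have "lebesgue_on (newpts n t) = restrict_space I1 (newpts n t)"
    by (subst restrict_restrict_space) (auto simp: newpts_sets intro!: arg_cong2[where f = restrict_space])
  ultimately show "(\<lambda>s. tup_cons n s t) \<in> lebesgue_on (newpts n t) \<rightarrow>\<^sub>M cube (Suc n)"
    by simp
qed

lemma tup_tail_measurable: "tup_tail n \<in> simplex_measure (Suc n) \<rightarrow>\<^sub>M simplex_measure n"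
  unfolding simplex_measure_alt
proof (rule measurable_restrict_space2)
  have m: "tup_tail n \<in> cube (Suc n) \<rightarrow>\<^sub>M cube n"
    unfolding tup_tail_def by (rule measurable_restrict) (auto intro!: measurable_component_singleton)
  then show "tup_tail n \<in> restrict_space (cube (Suc n)) (dset (Suc n)) \<rightarrow>\<^sub>M cube n"
    by (rule measurable_restrict_space1)
  show "tup_tail n \<in> space (restrict_space (cube (Suc n)) (dset (Suc n))) \<rightarrow> dset n"
  proof
    fix u assume "u \<in> space (restrict_space (cube (Suc n)) (dset (Suc n)))"
    then have u: "u \<in> space (cube (Suc n))" "\<And>i j. j < Suc n \<Longrightarrow> i < j \<Longrightarrow> u i > u j"
      by (simp_all add: space_restrict_space dset_def)
    have "tup_tail n u \<in> space (cube n)" using measurable_space[OF m u(1)] .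
    moreover have "tup_tail n u i > tup_tail n u j" if "j < n" "i < j" for i j
      using u(2)[of "Suc j" "Suc i"] that by (simp add: tup_tail_def)
    ultimately show "tup_tail n u \<in> dset n" by (simp add: dset_def)
  qed
qed

lemma head_measurable: "(\<lambda>u. u 0) \<in> simplex_measure (Suc n) \<rightarrow>\<^sub>M I1"
  unfolding simplex_measure_alt
  by (rule measurable_restrict_space1) (simp add: measurable_component_singleton)

lemma L2_iff: "g \<in> L2 M \<longleftrightarrow> g \<in> borel_measurable M \<and> (\<integral>\<^sup>+x. (ennreal (cmod (g x)))\<^sup>2 \<partial>M) < \<infinity>"
  unfolding L2_def by (auto simp: integrable_iff_bounded ennreal_power)

lemma L2_norm_eq:
  "g \<in> L2 M \<Longrightarrow> ennreal (LINT x|M. (cmod (g x))\<^sup>2) = (\<integral>\<^sup>+x. (ennreal (cmod (g x)))\<^sup>2 \<partial>M)"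
  unfolding L2_def by (auto simp: ennreal_power nn_integral_eq_integral)

lemma cnj_borel_measurable: "g \<in> borel_measurable M \<Longrightarrow> (\<lambda>x. cnj (g x)) \<in> borel_measurable M"
  by (rule measurable_compose[where g = cnj and N = borel])
     (auto intro!: borel_measurable_continuous_onI continuous_intros)

lemma L2_mult_integrable:
  assumes "g \<in> L2 M" "h \<in> L2 M"
  shows "integrable M (\<lambda>x. cnj (g x) * h x)"
proof (rule Bochner_Integration.integrable_bound)
  show "integrable M (\<lambda>x. (cmod (g x))\<^sup>2 + (cmod (h x))\<^sup>2)"
    using assms unfolding L2_def by auto
  show "(\<lambda>x. cnj (g x) * h x) \<in> borel_measurable M"
    using assms unfolding L2_def by (auto intro!: borel_measurable_times cnj_borel_measurable)
  have "a * b \<le> a\<^sup>2 + b\<^sup>2" for a b :: real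
    using zero_le_power2[of "a - b"] zero_le_power2[of "a + b"] unfolding power2_eq_square
    by (simp add: algebra_simps)
  then show "AE x in M. norm (cnj (g x) * h x) \<le> norm ((cmod (g x))\<^sup>2 + (cmod (h x))\<^sup>2)"
    by (simp add: norm_mult)
qed

lemma cfockI:
  assumes "\<phi> \<in> cfock" and m: "\<And>n. \<psi> n \<in> borel_measurable (simplex_measure n)"
    and b: "\<And>n. (\<integral>\<^sup>+t. (ennreal (cmod (\<psi> n t)))\<^sup>2 \<partial>simplex_measure n) \<le>
             ennreal C * (\<integral>\<^sup>+t. (ennreal (cmod (\<phi> (k n) t)))\<^sup>2 \<partial>simplex_measure (k n))"
    and "C \<ge> 0"
    and s: "summable (\<lambda>n. C * (LINT t|simplex_measure (k n). (cmod (\<phi> (k n) t))\<^sup>2))"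
  shows "\<psi> \<in> cfock"
proof -
  have \<phi>: "\<phi> n \<in> L2 (simplex_measure n)" for n using assms(1) by (simp add: cfock_def)
  then have b': "(\<integral>\<^sup>+t. (ennreal (cmod (\<psi> n t)))\<^sup>2 \<partial>simplex_measure n) \<le>
      ennreal (C * (LINT t|simplex_measure (k n). (cmod (\<phi> (k n) t))\<^sup>2))" for n
    using b[of n] \<open>C \<ge> 0\<close> by (simp add: ennreal_mult L2_norm_eq)
  have L: "\<psi> n \<in> L2 (simplex_measure n)" for n
    unfolding L2_iff using m le_less_trans[OF b'[of n]] by simp
  have "(LINT t|simplex_measure n. (cmod (\<psi> n t))\<^sup>2) \<le> C * (LINT t|simplex_measure (k n). (cmod (\<phi> (k n) t))\<^sup>2)" for n
    using b'[of n] \<open>C \<ge> 0\<close> unfolding L2_norm_eq[OF L, symmetric] by (subst (asm) ennreal_le_iff) auto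
  then have "summable (\<lambda>n. LINT t|simplex_measure n. (cmod (\<psi> n t))\<^sup>2)"
    by (intro summable_comparison_test'[OF s]) auto
  with L show ?thesis by (simp add: cfock_def)
qed

lemma c_create_comp_measurable:
  fixes f :: "real \<Rightarrow> complex" and g :: "(nat \<Rightarrow> real) \<Rightarrow> complex"
  assumes "f \<in> borel_measurable I1" "g \<in> borel_measurable (simplex_measure n)"
  shows "(\<lambda>u. f (u 0) * g (tup_tail n u)) \<in> borel_measurable (simplex_measure (Suc n))"
proof -
  have "(\<lambda>u. f (u 0)) \<in> borel_measurable (simplex_measure (Suc n))"
    by (rule measurable_compose[OF head_measurable assms(1)])
  moreover have "(\<lambda>u. g (tup_tail n u)) \<in> borel_measurable (simplex_measure (Suc n))"
    by (rule measurable_compose[OF tup_tail_measurable assms(2)])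
  ultimately show ?thesis by (rule borel_measurable_times)
qed

lemma newpts_mono: "(\<integral>\<^sup>+s. g s \<partial>lebesgue_on (newpts n t)) \<le> (\<integral>\<^sup>+s. g s \<partial>I1)"
  unfolding newpts_nn_integral by (intro nn_integral_mono) (auto simp: indicator_def)

lemma newpts_measurable: "g \<in> borel_measurable I1 \<Longrightarrow> g \<in> borel_measurable (lebesgue_on (newpts n t))"
proof -
  assume "g \<in> borel_measurable I1"
  then have "g \<in> borel_measurable (restrict_space I1 (newpts n t))"
    by (rule measurable_restrict_space1)
  moreover have "lebesgue_on (newpts n t) = restrict_space I1 (newpts n t)"
    by (subst restrict_restrict_space) (auto simp: newpts_sets intro!: arg_cong2[where f = restrict_space])
  ultimately show ?thesis by simp
qed

lemma c_create_bound:
  assumes f: "f \<in> L2 I1" and g: "g \<in> borel_measurable (simplex_measure n)"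
  shows "(\<integral>\<^sup>+u. (ennreal (cmod (f (u 0) * g (tup_tail n u))))\<^sup>2 \<partial>simplex_measure (Suc n)) \<le>
    ennreal (LINT s|I1. (cmod (f s))\<^sup>2) * (\<integral>\<^sup>+t. (ennreal (cmod (g t)))\<^sup>2 \<partial>simplex_measure n)"
proof -
  have fm: "f \<in> borel_measurable I1" using f by (simp add: L2_def)
  have [measurable]: "(\<lambda>u. f (u 0) * g (tup_tail n u)) \<in> borel_measurable (simplex_measure (Suc n))"
    by (rule c_create_comp_measurable[OF fm g])
  have "(\<integral>\<^sup>+u. (ennreal (cmod (f (u 0) * g (tup_tail n u))))\<^sup>2 \<partial>simplex_measure (Suc n)) =
     (\<integral>\<^sup>+t. \<integral>\<^sup>+s. (ennreal (cmod (f (tup_cons n s t 0) * g (tup_tail n (tup_cons n s t)))))\<^sup>2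
        \<partial>lebesgue_on (newpts n t) \<partial>simplex_measure n)"
    by (rule simplex_nn_integral) measurable
  also have "\<dots> = (\<integral>\<^sup>+t. \<integral>\<^sup>+s. (ennreal (cmod (f s)))\<^sup>2 * (ennreal (cmod (g t)))\<^sup>2
        \<partial>lebesgue_on (newpts n t) \<partial>simplex_measure n)"
    by (intro nn_integral_cong)
      (simp add: space_simplex dset_def tup_tail_cons tup_cons_0 norm_mult ennreal_mult power_mult_distrib)
  also have "\<dots> = (\<integral>\<^sup>+t. (\<integral>\<^sup>+s. (ennreal (cmod (f s)))\<^sup>2 \<partial>lebesgue_on (newpts n t)) *
        (ennreal (cmod (g t)))\<^sup>2 \<partial>simplex_measure n)"
    by (intro nn_integral_cong nn_integral_multc) (use newpts_measurable[OF fm] in measurable)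
  also have "\<dots> \<le> (\<integral>\<^sup>+t. ennreal (LINT s|I1. (cmod (f s))\<^sup>2) * (ennreal (cmod (g t)))\<^sup>2 \<partial>simplex_measure n)"
    unfolding L2_norm_eq[OF f] by (intro nn_integral_mono mult_right_mono newpts_mono) auto
  also have "\<dots> = ennreal (LINT s|I1. (cmod (f s))\<^sup>2) * (\<integral>\<^sup>+t. (ennreal (cmod (g t)))\<^sup>2 \<partial>simplex_measure n)"
    by (rule nn_integral_cmult) (use g in measurable)
  finally show ?thesis .
qed

lemma c_annih_bound:
  assumes f: "f \<in> L2 I1" and g: "g \<in> borel_measurable (simplex_measure (Suc n))"
  shows "(\<integral>\<^sup>+t. (ennreal (cmod (LINT s|lebesgue_on (newpts n t). cnj (f s) * g (tup_cons n s t))))\<^sup>2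
      \<partial>simplex_measure n) \<le>
    ennreal (LINT s|I1. (cmod (f s))\<^sup>2) * (\<integral>\<^sup>+u. (ennreal (cmod (g u)))\<^sup>2 \<partial>simplex_measure (Suc n))"
proof -
  have fm: "f \<in> borel_measurable I1" using f by (simp add: L2_def)
  have pt: "(ennreal (cmod (LINT s|lebesgue_on (newpts n t). cnj (f s) * g (tup_cons n s t))))\<^sup>2 \<le>
      ennreal (LINT s|I1. (cmod (f s))\<^sup>2) * (\<integral>\<^sup>+s. (ennreal (cmod (g (tup_cons n s t))))\<^sup>2 \<partial>lebesgue_on (newpts n t))"
    if t: "t \<in> dset n" for t
  proof -
    let ?A = "lebesgue_on (newpts n t)"
    have f': "f \<in> borel_measurable ?A" by (rule newpts_measurable[OF fm])
    have g': "(\<lambda>s. g (tup_cons n s t)) \<in> borel_measurable ?A"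
      by (rule measurable_compose[OF section_measurable[OF t] g])
    have "ennreal (cmod (LINT s|?A. cnj (f s) * g (tup_cons n s t))) \<le>
        (\<integral>\<^sup>+s. ennreal (cmod (cnj (f s) * g (tup_cons n s t))) \<partial>?A)"
      by (cases "integrable ?A (\<lambda>s. cnj (f s) * g (tup_cons n s t))")
        (auto simp: not_integrable_integral_eq intro: integral_norm_bound_ennreal)
    also have "\<dots> = (\<integral>\<^sup>+s. ennreal (cmod (f s)) * ennreal (cmod (g (tup_cons n s t))) \<partial>?A)"
      by (simp add: norm_mult ennreal_mult)
    finally have "(ennreal (cmod (LINT s|?A. cnj (f s) * g (tup_cons n s t))))\<^sup>2 \<le>
        (\<integral>\<^sup>+s. ennreal (cmod (f s)) * ennreal (cmod (g (tup_cons n s t))) \<partial>?A)\<^sup>2"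
      by (rule power_mono) simp
    also have "\<dots> \<le> (\<integral>\<^sup>+s. (ennreal (cmod (f s)))\<^sup>2 \<partial>?A) * (\<integral>\<^sup>+s. (ennreal (cmod (g (tup_cons n s t))))\<^sup>2 \<partial>?A)"
      by (rule Cauchy_Schwarz_nn_integral) (use f' g' in measurable)
    also have "\<dots> \<le> ennreal (LINT s|I1. (cmod (f s))\<^sup>2) * (\<integral>\<^sup>+s. (ennreal (cmod (g (tup_cons n s t))))\<^sup>2 \<partial>?A)"
      unfolding L2_norm_eq[OF f] by (intro mult_right_mono newpts_mono) simp
    finally show ?thesis .
  qed
  have [measurable]: "g \<in> borel_measurable (simplex_measure (Suc n))" by fact
  have "(\<integral>\<^sup>+t. (ennreal (cmod (LINT s|lebesgue_on (newpts n t). cnj (f s) * g (tup_cons n s t))))\<^sup>2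
      \<partial>simplex_measure n) \<le> (\<integral>\<^sup>+t. ennreal (LINT s|I1. (cmod (f s))\<^sup>2) *
        (\<integral>\<^sup>+s. (ennreal (cmod (g (tup_cons n s t))))\<^sup>2 \<partial>lebesgue_on (newpts n t)) \<partial>simplex_measure n)"
    by (intro nn_integral_mono pt) (simp add: space_simplex)
  also have "\<dots> = (\<integral>\<^sup>+t. \<integral>\<^sup>+s. ennreal (LINT s|I1. (cmod (f s))\<^sup>2) *
        (ennreal (cmod (g (tup_cons n s t))))\<^sup>2 \<partial>lebesgue_on (newpts n t) \<partial>simplex_measure n)"
  proof (intro nn_integral_cong nn_integral_cmult[symmetric])
    fix t assume "t \<in> space (simplex_measure n)"
    then have [measurable]: "(\<lambda>s. g (tup_cons n s t)) \<in> borel_measurable (lebesgue_on (newpts n t))"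
      by (intro measurable_compose[OF section_measurable g]) (simp add: space_simplex)
    show "(\<lambda>s. (ennreal (cmod (g (tup_cons n s t))))\<^sup>2) \<in> borel_measurable (lebesgue_on (newpts n t))"
      by measurable
  qed
  also have "\<dots> = (\<integral>\<^sup>+u. ennreal (LINT s|I1. (cmod (f s))\<^sup>2) * (ennreal (cmod (g u)))\<^sup>2 \<partial>simplex_measure (Suc n))"
    by (rule simplex_nn_integral[symmetric]) measurable
  also have "\<dots> = ennreal (LINT s|I1. (cmod (f s))\<^sup>2) * (\<integral>\<^sup>+u. (ennreal (cmod (g u)))\<^sup>2 \<partial>simplex_measure (Suc n))"
    by (rule nn_integral_cmult) measurable
  finally show ?thesis .
qed

lemma simplex_AE:
  assumes "AE u in simplex_measure (Suc n). P u"
  shows "AE t in simplex_measure n. AE s in lebesgue_on (newpts n t). P (tup_cons n s t)"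
proof -
  obtain N where N: "N \<in> sets (simplex_measure (Suc n))" "emeasure (simplex_measure (Suc n)) N = 0"
      "{u \<in> space (simplex_measure (Suc n)). \<not> P u} \<subseteq> N"
    using assms by (auto elim: AE_E)
  have [measurable]: "N \<in> sets (simplex_measure (Suc n))" by fact
  have [measurable]: "(\<lambda>u. indicator N u :: ennreal) \<in> borel_measurable (simplex_measure (Suc n))"
    by measurable
  have cm: "(\<lambda>t. \<integral>\<^sup>+s. indicator N (tup_cons n s t) \<partial>lebesgue_on (newpts n t)) \<in> borel_measurable (simplex_measure n)"
    by (rule simplex_nn_integral_measurable) measurable
  have "(\<integral>\<^sup>+t. (\<integral>\<^sup>+s. indicator N (tup_cons n s t) \<partial>lebesgue_on (newpts n t)) \<partial>simplex_measure n) = 0"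
    using simplex_nn_integral[of "indicator N" n] N by simp
  then have ae: "AE t in simplex_measure n. (\<integral>\<^sup>+s. indicator N (tup_cons n s t) \<partial>lebesgue_on (newpts n t)) = 0"
    using nn_integral_0_iff_AE[OF cm] by simp
  show ?thesis
  proof (rule AE_mp[OF ae], rule AE_I2, rule impI)
    fix t assume sp: "t \<in> space (simplex_measure n)"
      and t: "(\<integral>\<^sup>+s. indicator N (tup_cons n s t) \<partial>lebesgue_on (newpts n t)) = 0"
    note sm = section_measurable[OF sp[unfolded space_simplex]]
    show "AE s in lebesgue_on (newpts n t). P (tup_cons n s t)"
    proof -
      have "(\<lambda>s. indicator N (tup_cons n s t) :: ennreal) \<in> borel_measurable (lebesgue_on (newpts n t))"
        by (rule measurable_compose[OF sm]) measurable
      then have "AE s in lebesgue_on (newpts n t). indicator N (tup_cons n s t) = (0 :: ennreal)"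
        using t nn_integral_0_iff_AE by blast
      then show ?thesis
      proof (rule AE_mp, intro AE_I2 impI)
        fix s assume "s \<in> space (lebesgue_on (newpts n t))"
          and "indicator N (tup_cons n s t) = (0 :: ennreal)"
        then show "P (tup_cons n s t)"
          using N(3) measurable_space[OF sm] by (auto simp: indicator_def split: if_splits)
      qed
    qed
  qed
qed

lemma c_create_cfock:
  assumes "f \<in> L2 I1" "\<psi> \<in> cfock"
  shows "c_create f \<psi> \<in> cfock"
proof -
  have \<psi>: "\<psi> n \<in> borel_measurable (simplex_measure n)" for n
    using assms(2) by (simp add: cfock_def L2_def)
  let ?C = "LINT s|I1. (cmod (f s))\<^sup>2"
  have "summable (\<lambda>n. LINT t|simplex_measure n. (cmod (\<psi> n t))\<^sup>2)"
    using assms(2) by (simp add: cfock_def)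
  then have "summable (\<lambda>n. LINT t|simplex_measure (n - 1). (cmod (\<psi> (n - 1) t))\<^sup>2)"
    by (subst summable_Suc_iff[symmetric]) simp
  then have "summable (\<lambda>n. ?C * (LINT t|simplex_measure (n - 1). (cmod (\<psi> (n - 1) t))\<^sup>2))"
    by (rule summable_mult)
  then show ?thesis
  proof (rule cfockI[OF assms(2), rotated 3])
    fix n
    have fm: "f \<in> borel_measurable I1" using assms by (simp add: L2_def)
    show "c_create f \<psi> n \<in> borel_measurable (simplex_measure n)"
      using c_create_comp_measurable[OF fm \<psi>] by (cases n) (simp_all add: c_create_def)
    show "(\<integral>\<^sup>+t. (ennreal (cmod (c_create f \<psi> n t)))\<^sup>2 \<partial>simplex_measure n) \<le>
       ennreal ?C * (\<integral>\<^sup>+t. (ennreal (cmod (\<psi> (n - 1) t)))\<^sup>2 \<partial>simplex_measure (n - 1))"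
      using c_create_bound[OF assms(1) \<psi>] by (cases n) (simp_all add: c_create_def)
  qed simp
qed

lemma c_annih_cfock:
  assumes "f \<in> L2 I1" "\<psi> \<in> cfock"
  shows "c_annih f \<psi> \<in> cfock"
proof -
  have \<psi>: "\<psi> n \<in> borel_measurable (simplex_measure n)" for n
    using assms(2) by (simp add: cfock_def L2_def)
  let ?C = "LINT s|I1. (cmod (f s))\<^sup>2"
  have "summable (\<lambda>n. LINT t|simplex_measure n. (cmod (\<psi> n t))\<^sup>2)"
    using assms(2) by (simp add: cfock_def)
  then have "summable (\<lambda>n. LINT t|simplex_measure (Suc n). (cmod (\<psi> (Suc n) t))\<^sup>2)"
    by (subst summable_Suc_iff)
  then have "summable (\<lambda>n. ?C * (LINT t|simplex_measure (Suc n). (cmod (\<psi> (Suc n) t))\<^sup>2))"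
    by (rule summable_mult)
  then show ?thesis
  proof (rule cfockI[OF assms(2), rotated 3])
    fix n
    have fm: "f \<in> borel_measurable I1" using assms by (simp add: L2_def)
    have "(\<lambda>u. cnj (f (u 0)) * \<psi> (Suc n) u) \<in> borel_measurable (simplex_measure (Suc n))"
      by (intro borel_measurable_times \<psi> measurable_compose[OF head_measurable cnj_borel_measurable[OF fm]])
    from simplex_integral_measurable[OF this]
    show "c_annih f \<psi> n \<in> borel_measurable (simplex_measure n)"
      by (simp only: c_annih_def tup_cons_0)
    show "(\<integral>\<^sup>+t. (ennreal (cmod (c_annih f \<psi> n t)))\<^sup>2 \<partial>simplex_measure n) \<le>
       ennreal ?C * (\<integral>\<^sup>+t. (ennreal (cmod (\<psi> (Suc n) t)))\<^sup>2 \<partial>simplex_measure (Suc n))"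
      unfolding c_annih_def by (rule c_annih_bound[OF assms(1) \<psi>])
  qed simp
qed

lemma c_adjoint:
  assumes f: "f \<in> L2 (lebesgue_on {0..1})" and \<phi>: "\<phi> \<in> cfock" and \<psi>: "\<psi> \<in> cfock"
  shows "c_inner (c_create f \<phi>) \<psi> = c_inner \<phi> (c_annih f \<psi>)"
proof -
  have "(LINT u|simplex_measure (Suc n). cnj (c_create f \<phi> (Suc n) u) * \<psi> (Suc n) u) =
      (LINT t|simplex_measure n. cnj (\<phi> n t) * c_annih f \<psi> n t)" for n
  proof -
    have "integrable (simplex_measure (Suc n)) (\<lambda>u. cnj (c_create f \<phi> (Suc n) u) * \<psi> (Suc n) u)"
      using c_create_cfock[OF f \<phi>] \<psi> by (intro L2_mult_integrable) (auto simp: cfock_def)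
    from simplex_integral[OF this]
    have "(LINT u|simplex_measure (Suc n). cnj (c_create f \<phi> (Suc n) u) * \<psi> (Suc n) u) =
      (LINT t|simplex_measure n. LINT s|lebesgue_on (newpts n t).
         cnj (c_create f \<phi> (Suc n) (tup_cons n s t)) * \<psi> (Suc n) (tup_cons n s t))" .
    also have "\<dots> = (LINT t|simplex_measure n. LINT s|lebesgue_on (newpts n t).
         cnj (\<phi> n t) * (cnj (f s) * \<psi> (Suc n) (tup_cons n s t)))"
      by (intro Bochner_Integration.integral_cong refl)
        (simp add: c_create_def tup_cons_0 tup_tail_cons space_simplex dset_def)
    also have "\<dots> = (LINT t|simplex_measure n. cnj (\<phi> n t) * c_annih f \<psi> n t)"
      unfolding c_annih_def by (simp only: Bochner_Integration.integral_mult_right_zero)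
    finally show ?thesis .
  qed
  then have "(\<lambda>n. LINT u|simplex_measure n. cnj (c_create f \<phi> n u) * \<psi> n u) sums s \<longleftrightarrow>
      (\<lambda>n. LINT t|simplex_measure n. cnj (\<phi> n t) * c_annih f \<psi> n t) sums s" for s
    using sums_Suc_iff[of "\<lambda>n. LINT u|simplex_measure n. cnj (c_create f \<phi> n u) * \<psi> n u" s]
    by (simp add: c_create_def)
  then show ?thesis
    unfolding c_inner_def suminf_def by (intro arg_cong[where f = The] ext) blast
qed

lemma c_annih_cong:
  assumes f: "f \<in> L2 (lebesgue_on {0..1})" and \<phi>: "\<phi> \<in> cfock" and \<psi>: "\<psi> \<in> cfock" and eq: "c_eq \<phi> \<psi>"
  shows "c_eq (c_annih f \<phi>) (c_annih f \<psi>)"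
  unfolding c_eq_def
proof
  fix n
  have m: "\<phi> k \<in> borel_measurable (simplex_measure k)" "\<psi> k \<in> borel_measurable (simplex_measure k)" for k
    using \<phi> \<psi> by (simp_all add: cfock_def L2_def)
  have fm: "f \<in> borel_measurable I1" using f by (simp add: L2_def)
  have "AE t in simplex_measure n. AE s in lebesgue_on (newpts n t).
      \<phi> (Suc n) (tup_cons n s t) = \<psi> (Suc n) (tup_cons n s t)"
    using eq unfolding c_eq_def by (intro simplex_AE) simp
  then show "AE t in simplex_measure n. c_annih f \<phi> n t = c_annih f \<psi> n t"
  proof (rule AE_mp, intro AE_I2 impI)
    fix t assume "t \<in> space (simplex_measure n)"
      and ae: "AE s in lebesgue_on (newpts n t). \<phi> (Suc n) (tup_cons n s t) = \<psi> (Suc n) (tup_cons n s t)"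
    then have t: "t \<in> dset n" by (simp add: space_simplex)
    have cf: "(\<lambda>s. cnj (f s)) \<in> borel_measurable (lebesgue_on (newpts n t))"
      by (rule newpts_measurable[OF cnj_borel_measurable[OF fm]])
    show "c_annih f \<phi> n t = c_annih f \<psi> n t"
      unfolding c_annih_def
    proof (rule integral_cong_AE)
      show "AE s in lebesgue_on (newpts n t). cnj (f s) * \<phi> (Suc n) (tup_cons n s t) =
          cnj (f s) * \<psi> (Suc n) (tup_cons n s t)"
        using ae by (rule AE_mp) simp
    qed (intro borel_measurable_times cf measurable_compose[OF section_measurable[OF t] m(1)]
           measurable_compose[OF section_measurable[OF t] m(2)])+
  qed
qed

lemma c_create_cong:
  assumes f: "f \<in> L2 (lebesgue_on {0..1})" and \<phi>: "\<phi> \<in> cfock" and \<psi>: "\<psi> \<in> cfock" and eq: "c_eq \<phi> \<psi>"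
  shows "c_eq (c_create f \<phi>) (c_create f \<psi>)"
  unfolding c_eq_def
proof
  fix n
  have fm: "f \<in> borel_measurable I1" using f by (simp add: L2_def)
  have m: "\<phi> k \<in> borel_measurable (simplex_measure k)" "\<psi> k \<in> borel_measurable (simplex_measure k)" for k
    using \<phi> \<psi> by (simp_all add: cfock_def L2_def)
  show "AE t in simplex_measure n. c_create f \<phi> n t = c_create f \<psi> n t"
  proof (cases n)
    case (Suc k)
    have d: "(\<lambda>t. \<phi> k t - \<psi> k t) \<in> borel_measurable (simplex_measure k)"
      by (rule borel_measurable_diff[OF m])
    have z: "(\<integral>\<^sup>+t. (ennreal (cmod (\<phi> k t - \<psi> k t)))\<^sup>2 \<partial>simplex_measure k) = 0"
      using eq d unfolding c_eq_def by (subst nn_integral_0_iff_AE) (auto elim: AE_mp)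
    have d': "(\<lambda>u. f (u 0) * (\<phi> k (tup_tail k u) - \<psi> k (tup_tail k u))) \<in> borel_measurable (simplex_measure (Suc k))"
      by (rule c_create_comp_measurable[OF fm d])
    have "(\<integral>\<^sup>+u. (ennreal (cmod (f (u 0) * (\<phi> k (tup_tail k u) - \<psi> k (tup_tail k u)))))\<^sup>2 \<partial>simplex_measure (Suc k)) = 0"
      using c_create_bound[OF f d] z by simp
    then have "AE u in simplex_measure (Suc k). (ennreal (cmod (f (u 0) * (\<phi> k (tup_tail k u) - \<psi> k (tup_tail k u)))))\<^sup>2 = 0"
      using d' by (subst (asm) nn_integral_0_iff_AE) auto
    then show ?thesis
      unfolding Suc c_create_def by (rule AE_mp) (auto simp: algebra_simps)
  qed (simp add: c_create_def)
qed

end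

(* In both Fock spaces every vector obtained from the vacuum is a scalar times an elementary tensor
   g_1(t_1) ... g_k(t_k) restricted to t_1 > ... > t_k.  Creation by f prepends f.  Annihilation by f
   removes g_1 and multiplies g_2 by the function x |-> int_x^1 cnj f g_1 (the scalar, if k = 1, by
   int_0^1 cnj f g_1); in the discrete space the integral is replaced by the Riemann sum over the
   points i/N > x.  Such Riemann sums converge uniformly in x as soon as the total oscillation of
   the integrand over the uniform partition vanishes, a property that holds for Riemann integrable
   functions and is preserved by products and by x |-> int_x^1.  Hence the two computations stay
   uniformly close along the whole word, and the scalar left at the end converges.  It contributes
   to the vacuum state only if the tensor is empty, which excludes words of odd length. *)

theory Submission
  imports Defs
begin

section \<open>Uniform partitions of the unit interval and oscillation sums\<close>

definition cell :: "nat \<Rightarrow> nat \<Rightarrow> real set" where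
  "cell N k = {(real k - 1) / real N .. real k / real N}"

text \<open>Darboux's criterion along uniform partitions. Comparing two arbitrary tags in each cell
  replaces upper and lower sums, which make no sense for complex values. The factor \<open>N\<close>
  on the right stands for the cell measure \<open>1 / N\<close>.\<close>

definition vanishing_osc :: "(real \<Rightarrow> complex) \<Rightarrow> bool" where
  "vanishing_osc f \<longleftrightarrow> (\<forall>e>0. \<forall>\<^sub>F N in sequentially. \<forall>x y.
     (\<forall>k\<in>{1..N}. x k \<in> cell N k \<and> y k \<in> cell N k) \<longrightarrow>
     (\<Sum>k=1..N. cmod (f (x k) - f (y k))) \<le> e * real N)"

text \<open>Measurability and boundedness give Lebesgue integrability, and the oscillation condition
  makes Riemann sums converge. All three pass to products and to \<open>upper_integral\<close>, so
  the induction over words can stay inside this class.\<close>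

definition darboux :: "(real \<Rightarrow> complex) set" where
  "darboux = {f \<in> borel_measurable (lebesgue_on {0..1}). bounded (f ` {0..1}) \<and> vanishing_osc f}"

lemma Im_le_cmod: "Im z \<le> cmod z"
  by (rule order_trans[OF abs_ge_self abs_Im_le_cmod])

lemma cell_subset: "k \<in> {1..N} \<Longrightarrow> cell N k \<subseteq> {0..1}"
  by (auto simp: cell_def field_simps intro: order_trans[of _ "real k"])

lemma cell_tagged_division:
  assumes "N \<ge> 1" and x: "\<And>k. k \<in> {1..N} \<Longrightarrow> x k \<in> cell N k"
  shows "(\<lambda>k. (x k, cell N k)) ` {1..N} tagged_division_of {0..1}"
proof (rule tagged_division_ofI)
  have N: "real N > 0" using assms by simp
  fix a K assume aK: "(a, K) \<in> (\<lambda>k. (x k, cell N k)) ` {1..N}"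
  then obtain k where k: "k \<in> {1..N}" "a = x k" "K = cell N k" by auto
  show "a \<in> K" using k x by simp
  show "K \<subseteq> {0..1}" using k cell_subset by simp
  show "\<exists>a b. K = cbox a b" unfolding k cell_def interval_cbox by blast
  fix a' K' assume "(a', K') \<in> (\<lambda>k. (x k, cell N k)) ` {1..N}" and ne: "(a, K) \<noteq> (a', K')"
  then obtain k' where k': "k' \<in> {1..N}" "a' = x k'" "K' = cell N k'" by blast
  have "k \<noteq> k'" using ne k k' by auto
  then have "real k \<le> real k' - 1 \<or> real k' \<le> real k - 1" by linarith
  then have "real k / real N \<le> (real k' - 1) / real N \<or> real k' / real N \<le> (real k - 1) / real N"
    using N by (auto simp only: divide_right_mono less_imp_le)
  then show "interior K \<inter> interior K' = {}"
    unfolding k k' cell_def interior_atLeastAtMost_real by auto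
next
  show "\<Union>{K. \<exists>a. (a, K) \<in> (\<lambda>k. (x k, cell N k)) ` {1..N}} = {0..1}"
  proof (intro subset_antisym subsetI)
    fix t :: real assume t: "t \<in> {0..1}"
    have N: "real N > 0" using assms by simp
    \<comment> \<open>The ceiling selects the cell whose half-open version
      \<open>((k - 1) / N, k / N]\<close> contains \<open>t\<close>; at \<open>t = 0\<close> it
      would give the invalid index 0.\<close>
    define k where "k = (if t = 0 then 1 else nat \<lceil>t * real N\<rceil>)"
    have "k \<in> {1..N} \<and> t \<in> cell N k"
    proof (cases "t = 0")
      case True
      then show ?thesis using assms by (simp add: k_def cell_def)
    next
      case False
      then have p: "t * real N > 0" "t * real N \<le> real N" using t N by (auto simp: mult_le_cancel_right1)
      then have "\<lceil>t * real N\<rceil> \<ge> 1" by linarith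
      then have c: "real_of_int \<lceil>t * real N\<rceil> = real k" "k \<ge> 1" using False unfolding k_def by (auto simp: le_nat_iff)
      have "real k \<le> real N" using p c ceiling_le_iff[of "t * real N" "int N"] by simp
      moreover have "real k - 1 < t * real N" "t * real N \<le> real k" using c(1) by linarith+
      ultimately show ?thesis using c N by (auto simp: cell_def field_simps)
    qed
    then show "t \<in> \<Union>{K. \<exists>a. (a, K) \<in> (\<lambda>k. (x k, cell N k)) ` {1..N}}" by blast
  qed (use cell_subset in blast)
qed simp

lemma cell_props:
  assumes "k \<in> {1..N}"
  shows "measure lborel (cell N k) = 1 / real N" "diameter (cell N k) = 1 / real N"
proof -
  have "(real k - 1) / real N \<le> real k / real N" by (simp add: divide_right_mono)
  moreover have "real k / real N - (real k - 1) / real N = 1 / real N"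
    by (simp add: diff_divide_distrib)
  ultimately show "measure lborel (cell N k) = 1 / real N" "diameter (cell N k) = 1 / real N"
    unfolding cell_def by (simp_all add: diameter_closed_interval)
qed

lemma Sup_cell: "Sup (cell N k) = real k / real N"
  unfolding cell_def by (rule cSup_atLeastAtMost) (simp add: divide_right_mono)

text \<open>Neighbouring cells may share a tag, so the tags alone do not determine the index; the
  pairs are distinct because \<open>k\<close> can be read off from the supremum of its cell.\<close>

lemma cell_division_sum:
  fixes f :: "real \<Rightarrow> complex"
  assumes "N \<ge> 1"
  shows "(\<Sum>(a, K)\<in>(\<lambda>k. (x k, cell N k)) ` {1..N}. measure lborel K *\<^sub>R f a) =
         (\<Sum>k=1..N. f (x k) /\<^sub>R real N)"
proof -
  have "inj_on (\<lambda>k. (x k, cell N k)) {1..N}"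
  proof (rule inj_onI)
    fix k l assume "(x k, cell N k) = (x l, cell N l)"
    then have "Sup (cell N k) = Sup (cell N l)" by simp
    then show "k = l" using assms by (simp add: Sup_cell)
  qed
  then have "(\<Sum>(a, K)\<in>(\<lambda>k. (x k, cell N k)) ` {1..N}. measure lborel K *\<^sub>R f a) =
      (\<Sum>k=1..N. measure lborel (cell N k) *\<^sub>R f (x k))"
    by (subst sum.reindex) simp_all
  also have "\<dots> = (\<Sum>k=1..N. f (x k) /\<^sub>R real N)"
    by (rule sum.cong) (simp_all only: cell_props divide_inverse mult_1)
  finally show ?thesis .
qed

text \<open>Only sums of signed differences are controlled by the definition of the integral.  The absolute
  values are recovered by swapping the two tags of a cell whenever the difference has the wrong
  sign, separately for the real and the imaginary part.\<close>
lemma riemann_integrable_vanishing_osc: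
  assumes "riemann_integrable_01 f"
  shows "vanishing_osc f"
  unfolding vanishing_osc_def
proof (intro allI impI)
  fix e :: real assume e: "e > 0"
  obtain I where I: "\<forall>e>0. \<exists>d>0. \<forall>p. p tagged_division_of {0..1} \<and> (\<forall>(x, K)\<in>p. diameter K < d) \<longrightarrow>
        norm ((\<Sum>(x, K)\<in>p. measure lborel K *\<^sub>R f x) - I) < e"
    using assms unfolding riemann_integrable_01_def by blast
  \<comment> \<open>Two Riemann sums within \<open>e / 4\<close> of \<open>I\<close> differ by less
    than \<open>e / 2\<close>, and the real and the imaginary part each use up one such
    half.\<close>
  obtain d where d: "d > 0" "\<And>p. p tagged_division_of {0..1} \<Longrightarrow> (\<forall>(x, K)\<in>p. diameter K < d) \<Longrightarrow>
        norm ((\<Sum>(x, K)\<in>p. measure lborel K *\<^sub>R f x) - I) < e / 4"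
    using I[rule_format, of "e / 4"] e by auto
  have "\<forall>\<^sub>F N in sequentially. 1 / real N < d"
    using d(1) by (rule order_tendstoD[OF lim_1_over_n])
  with eventually_ge_at_top[of 1] show "\<forall>\<^sub>F N in sequentially. \<forall>x y.
     (\<forall>k\<in>{1..N}. x k \<in> cell N k \<and> y k \<in> cell N k) \<longrightarrow>
     (\<Sum>k=1..N. cmod (f (x k) - f (y k))) \<le> e * real N"
  proof eventually_elim
    case (elim N)
    have near: "norm ((\<Sum>k=1..N. f (x k) /\<^sub>R real N) - I) < e / 4"
      if "\<And>k. k \<in> {1..N} \<Longrightarrow> x k \<in> cell N k" for x
    proof -
      have "\<forall>(a, K)\<in>(\<lambda>k. (x k, cell N k)) ` {1..N}. diameter K < d"
        using elim by (auto simp: cell_props)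
      from d(2)[OF cell_tagged_division[OF elim(1) that] this] show ?thesis
        unfolding cell_division_sum[OF elim(1)] .
    qed
    have diff: "norm (\<Sum>k=1..N. f (x k) - f (y k)) \<le> e / 2 * real N"
      if "\<And>k. k \<in> {1..N} \<Longrightarrow> x k \<in> cell N k" "\<And>k. k \<in> {1..N} \<Longrightarrow> y k \<in> cell N k" for x y
    proof -
      have "norm ((\<Sum>k=1..N. f (x k) /\<^sub>R real N) - I) < e / 4"
        "norm ((\<Sum>k=1..N. f (y k) /\<^sub>R real N) - I) < e / 4"
        by (rule near, rule that, assumption)+
      then have "norm ((\<Sum>k=1..N. f (x k) /\<^sub>R real N) - (\<Sum>k=1..N. f (y k) /\<^sub>R real N)) < e / 2"
        using norm_triangle_ineq4[of "(\<Sum>k=1..N. f (x k) /\<^sub>R real N) - I"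
            "(\<Sum>k=1..N. f (y k) /\<^sub>R real N) - I"] by simp
      moreover have "(\<Sum>k=1..N. f (x k) /\<^sub>R real N) - (\<Sum>k=1..N. f (y k) /\<^sub>R real N) =
          (\<Sum>k=1..N. f (x k) - f (y k)) /\<^sub>R real N"
        by (simp add: sum_subtractf scaleR_diff_right scaleR_sum_right)
      ultimately show ?thesis using elim by (simp add: field_simps)
    qed
    have part: "(\<Sum>k=1..N. \<bar>g (f (x k)) - g (f (y k))\<bar>) \<le> e / 2 * real N"
      if g: "g = Re \<or> g = Im" and xy: "\<forall>k\<in>{1..N}. x k \<in> cell N k \<and> y k \<in> cell N k" for g x y
    proof -
      define x' where "x' k = (if g (f (x k)) \<ge> g (f (y k)) then x k else y k)" for k
      define y' where "y' k = (if g (f (x k)) \<ge> g (f (y k)) then y k else x k)" for k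
      have "(\<Sum>k=1..N. \<bar>g (f (x k)) - g (f (y k))\<bar>) = (\<Sum>k=1..N. g (f (x' k)) - g (f (y' k)))"
        by (intro sum.cong) (auto simp: x'_def y'_def)
      also have "\<dots> = g (\<Sum>k=1..N. f (x' k) - f (y' k))" using g by auto
      also have "\<dots> \<le> norm (\<Sum>k=1..N. f (x' k) - f (y' k))"
        using g complex_Re_le_cmod Im_le_cmod by blast
      also have "\<dots> \<le> e / 2 * real N"
        by (rule diff) (use xy in \<open>auto simp: x'_def y'_def\<close>)
      finally show ?thesis .
    qed
    show ?case
    proof (intro allI impI)
      fix x y assume xy: "\<forall>k\<in>{1..N}. x k \<in> cell N k \<and> y k \<in> cell N k"
      have "(\<Sum>k=1..N. cmod (f (x k) - f (y k))) \<le>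
          (\<Sum>k=1..N. \<bar>Re (f (x k)) - Re (f (y k))\<bar> + \<bar>Im (f (x k)) - Im (f (y k))\<bar>)"
        by (intro sum_mono order_trans[OF cmod_le]) simp
      also have "\<dots> \<le> e * real N"
        using part[of Re, OF _ xy] part[of Im, OF _ xy] by (simp add: sum.distrib)
      finally show "(\<Sum>k=1..N. cmod (f (x k) - f (y k))) \<le> e * real N" .
    qed
  qed
qed

section \<open>The class \<open>darboux\<close>: membership of Riemann integrable functions and
  closure properties\<close>

lemma riemann_bounded_darboux: "f \<in> riemann_bounded_01 \<Longrightarrow> f \<in> darboux"
  using riemann_bounded_01_L2[of f] riemann_integrable_vanishing_osc[of f]
  by (auto simp: darboux_def riemann_bounded_01_def L2_def)

lemma darboux_bound:
  assumes "f \<in> darboux"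
  obtains B where "B > 0" "\<And>x. x \<in> {0..1} \<Longrightarrow> cmod (f x) \<le> B"
  using assms by (auto simp: darboux_def bounded_pos)

lemma darboux_osc:
  assumes "f \<in> darboux" "e > 0"
  shows "\<forall>\<^sub>F N in sequentially. \<forall>x y. (\<forall>k\<in>{1..N}. x k \<in> cell N k \<and> y k \<in> cell N k) \<longrightarrow>
     (\<Sum>k=1..N. cmod (f (x k) - f (y k))) \<le> e * real N"
  using assms unfolding darboux_def vanishing_osc_def by blast

lemma darboux_cnj:
  assumes "f \<in> darboux"
  shows "(\<lambda>x. cnj (f x)) \<in> darboux"
proof -
  have "(\<lambda>x. cnj (f x)) \<in> borel_measurable (lebesgue_on {0..1})"
    using assms by (intro borel_measurable_continuous_on[where f = cnj]) (auto simp: darboux_def intro: continuous_intros)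
  moreover have "cmod (cnj a - cnj b) = cmod (a - b)" for a b
    by (metis complex_cnj_diff complex_mod_cnj)
  ultimately show ?thesis
    using assms by (simp add: darboux_def vanishing_osc_def bounded_iff)
qed

text \<open>A Leibniz rule for oscillations: with bounds \<open>A\<close> of \<open>f\<close> and
  \<open>B\<close> of \<open>g\<close>, the oscillation sum of the product is at most
  \<open>B\<close> times that of \<open>f\<close> plus \<open>A\<close> times that of
  \<open>g\<close>.\<close>

lemma darboux_mult:
  assumes f: "f \<in> darboux" and g: "g \<in> darboux"
  shows "(\<lambda>x. f x * g x) \<in> darboux"
proof -
  obtain A where A: "A > 0" "\<And>x. x \<in> {0..1} \<Longrightarrow> cmod (f x) \<le> A" using darboux_bound[OF f] by blast
  obtain B where B: "B > 0" "\<And>x. x \<in> {0..1} \<Longrightarrow> cmod (g x) \<le> B" using darboux_bound[OF g] by blast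
  have "vanishing_osc (\<lambda>x. f x * g x)"
    unfolding vanishing_osc_def
  proof (intro allI impI)
    fix e :: real assume e: "e > 0"
    have "\<forall>\<^sub>F N in sequentially. \<forall>x y. (\<forall>k\<in>{1..N}. x k \<in> cell N k \<and> y k \<in> cell N k) \<longrightarrow>
       (\<Sum>k=1..N. cmod (f (x k) - f (y k))) \<le> e / (2 * B) * real N"
      by (rule darboux_osc[OF f]) (use e B(1) in simp)
    moreover have "\<forall>\<^sub>F N in sequentially. \<forall>x y. (\<forall>k\<in>{1..N}. x k \<in> cell N k \<and> y k \<in> cell N k) \<longrightarrow>
       (\<Sum>k=1..N. cmod (g (x k) - g (y k))) \<le> e / (2 * A) * real N"
      by (rule darboux_osc[OF g]) (use e A(1) in simp)
    ultimately show "\<forall>\<^sub>F N in sequentially. \<forall>x y. (\<forall>k\<in>{1..N}. x k \<in> cell N k \<and> y k \<in> cell N k) \<longrightarrow>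
       (\<Sum>k=1..N. cmod (f (x k) * g (x k) - f (y k) * g (y k))) \<le> e * real N"
    proof eventually_elim
      case (elim N)
      show ?case
      proof (intro allI impI)
        fix x y assume xy: "\<forall>k\<in>{1..N}. x k \<in> cell N k \<and> y k \<in> cell N k"
        have "cmod (f (x k) * g (x k) - f (y k) * g (y k)) \<le>
            B * cmod (f (x k) - f (y k)) + A * cmod (g (x k) - g (y k))" if k: "k \<in> {1..N}" for k
        proof -
          have in01: "x k \<in> {0..1}" "y k \<in> {0..1}" using k xy cell_subset by blast+
          have "f (x k) * g (x k) - f (y k) * g (y k) =
              (f (x k) - f (y k)) * g (x k) + f (y k) * (g (x k) - g (y k))"
            by (simp add: algebra_simps)
          also have "cmod \<dots> \<le> cmod (f (x k) - f (y k)) * cmod (g (x k)) +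
              cmod (f (y k)) * cmod (g (x k) - g (y k))"
            using norm_triangle_ineq by (metis norm_mult)
          also have "\<dots> \<le> cmod (f (x k) - f (y k)) * B + A * cmod (g (x k) - g (y k))"
            using A B in01 by (intro add_mono mult_mono) auto
          finally show ?thesis by (simp add: mult.commute)
        qed
        then have "(\<Sum>k=1..N. cmod (f (x k) * g (x k) - f (y k) * g (y k))) \<le>
            (\<Sum>k=1..N. B * cmod (f (x k) - f (y k)) + A * cmod (g (x k) - g (y k)))"
          by (rule sum_mono)
        also have "\<dots> = B * (\<Sum>k=1..N. cmod (f (x k) - f (y k))) + A * (\<Sum>k=1..N. cmod (g (x k) - g (y k)))"
          by (simp add: sum.distrib sum_distrib_left)
        also have "\<dots> \<le> B * (e / (2 * B) * real N) + A * (e / (2 * A) * real N)"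
          using elim xy A(1) B(1) by (intro add_mono mult_left_mono) auto
        also have "\<dots> = e * real N" using A(1) B(1) by simp
        finally show "(\<Sum>k=1..N. cmod (f (x k) * g (x k) - f (y k) * g (y k))) \<le> e * real N" .
      qed
    qed
  qed
  moreover have "(\<lambda>x. f x * g x) \<in> borel_measurable (lebesgue_on {0..1})"
    using f g by (auto simp: darboux_def)
  moreover have "bounded ((\<lambda>x. f x * g x) ` {0..1})"
    unfolding bounded_iff using A B by (auto intro!: exI[of _ "A * B"] simp: norm_mult mult_mono)
  ultimately show ?thesis by (simp add: darboux_def)
qed

text \<open>Within a cell of length \<open>1 / N\<close> all differences are at most
  \<open>C / N\<close>. This is the way in which functions of the form
  \<open>upper_integral F\<close> enter the class.\<close>

lemma Lipschitz_darboux: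
  assumes L: "\<And>x y. x \<in> {0..1} \<Longrightarrow> y \<in> {0..1} \<Longrightarrow> cmod (f x - f y) \<le> C * \<bar>x - y\<bar>"
  shows "f \<in> darboux"
proof -
  have "C-lipschitz_on {0..1} f"
  proof (rule lipschitz_onI)
    \<comment> \<open>The points 0 and 1 have distance 1, so \<open>C\<close> dominates a
      norm.\<close>
    show "C \<ge> 0" using order_trans[OF norm_ge_zero L[of 0 1]] by simp
  qed (use L in \<open>auto simp: dist_norm\<close>)
  then have cont: "continuous_on {0..1} f"
    by (rule lipschitz_on_continuous_on)
  moreover have "compact (f ` {0..1})"
    using cont by (intro compact_continuous_image) auto
  moreover have "vanishing_osc f"
    unfolding vanishing_osc_def
  proof (intro allI impI)
    fix e :: real assume e: "e > 0"
    have "(\<lambda>N. C / real N) \<longlonglongrightarrow> 0" by (rule lim_const_over_n)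
    then have "\<forall>\<^sub>F N in sequentially. C / real N < e" by (rule order_tendstoD) (rule e)
    then show "\<forall>\<^sub>F N in sequentially. \<forall>x y. (\<forall>k\<in>{1..N}. x k \<in> cell N k \<and> y k \<in> cell N k) \<longrightarrow>
       (\<Sum>k=1..N. cmod (f (x k) - f (y k))) \<le> e * real N"
    proof eventually_elim
      case (elim N)
      show ?case
      proof (intro allI impI)
        fix x y assume xy: "\<forall>k\<in>{1..N}. x k \<in> cell N k \<and> y k \<in> cell N k"
        have "cmod (f (x k) - f (y k)) \<le> e" if k: "k \<in> {1..N}" for k
        proof -
          have in01: "x k \<in> {0..1}" "y k \<in> {0..1}" using k xy cell_subset by blast+
          have "\<bar>x k - y k\<bar> \<le> 1 / real N"
            using xy[rule_format, OF k] by (auto simp: cell_def diff_divide_distrib)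
          then have "C * \<bar>x k - y k\<bar> \<le> C * (1 / real N)"
            using \<open>C-lipschitz_on {0..1} f\<close> by (intro mult_left_mono) (auto dest: lipschitz_on_nonneg)
          then show ?thesis using L[OF in01] elim by simp
        qed
        then have "(\<Sum>k=1..N. cmod (f (x k) - f (y k))) \<le> (\<Sum>k=1..N. e)"
          by (rule sum_mono)
        then show "(\<Sum>k=1..N. cmod (f (x k) - f (y k))) \<le> e * real N" by (simp add: mult.commute)
      qed
    qed
  qed
  ultimately show ?thesis
    unfolding darboux_def
    by (auto intro: continuous_imp_measurable_on_sets_lebesgue compact_imp_bounded)
qed

section \<open>Integrals over upper intervals and their Riemann sums\<close>

definition upper_integral :: "(real \<Rightarrow> complex) \<Rightarrow> real \<Rightarrow> complex" where
  "upper_integral F x = (LINT s|lebesgue_on {s \<in> {0..1}. s > x}. F s)"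

lemma darboux_integrable_on:
  assumes "F \<in> darboux" "0 \<le> a" "b \<le> 1"
  shows "F absolutely_integrable_on {a..b}"
proof -
  obtain B where B: "\<And>x. x \<in> {0..1} \<Longrightarrow> cmod (F x) \<le> B" using darboux_bound[OF assms(1)] by blast
  have "F absolutely_integrable_on {0..1}"
    using assms(1) B
    by (intro measurable_bounded_by_integrable_imp_absolutely_integrable[where g = "\<lambda>_. B"])
       (auto simp: darboux_def)
  then show ?thesis
    by (rule set_integrable_subset) (use assms in auto)
qed

text \<open>Only the null set \<open>{x}\<close> separates the two domains. The gauge integral over
  a closed interval brings in additivity over adjacent intervals.\<close>

lemma upper_integral_eq:
  assumes "F \<in> darboux" "x \<in> {0..1}"
  shows "upper_integral F x = integral {x..1} F"
proof -
  have e: "{s \<in> {0..1}. s > x} = {x<..1}" using assms by auto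
  have "F absolutely_integrable_on {x<..1}"
    by (rule set_integrable_subset[OF darboux_integrable_on[OF assms(1), of 0 1]]) (use assms in auto)
  then have "integrable (lebesgue_on {x<..1}) F"
    by (simp add: integrable_restrict_space set_integrable_def)
  then have "upper_integral F x = integral {x<..1} F"
    unfolding upper_integral_def e by (rule lebesgue_integral_eq_integral) auto
  also have "\<dots> = integral {x..1} F"
    by (rule integral_spike_set) (auto intro: negligible_subset[of "{x}"])
  finally show ?thesis .
qed

text \<open>For \<open>n = 0\<close>, \<open>c_annih\<close> integrates over the closed unit
  interval, whereas \<open>upper_integral\<close> leaves out its lower end; this identity joins the
  two cases.\<close>

lemma lebesgue_integral_eq_upper:
  assumes "F \<in> darboux"
  shows "(LINT s|lebesgue_on {0..1}. F s) = upper_integral F 0"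
proof -
  have "integrable (lebesgue_on {0..1}) F"
    using darboux_integrable_on[OF assms, of 0 1] by (simp add: integrable_restrict_space set_integrable_def)
  then show ?thesis
    using upper_integral_eq[OF assms, of 0] lebesgue_integral_eq_integral[of "{0..1}" F] by simp
qed

text \<open>The difference of two values is an integral of \<open>F\<close> over the interval
  between them, so a bound of \<open>F\<close> is a Lipschitz constant.\<close>

lemma upper_integral_darboux:
  assumes F: "F \<in> darboux"
  shows "upper_integral F \<in> darboux"
proof -
  obtain B where B: "B > 0" "\<And>x. x \<in> {0..1} \<Longrightarrow> cmod (F x) \<le> B" using darboux_bound[OF F] by blast
  have le: "cmod (upper_integral F x - upper_integral F y) \<le> B * (y - x)"
    if xy: "x \<in> {0..1}" "y \<in> {0..1}" "x \<le> y" for x y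
  proof -
    have "integral {x..y} F + integral {y..1} F = integral {x..1} F"
      using xy set_lebesgue_integral_eq_integral(1)[OF darboux_integrable_on[OF F, of x 1]]
      by (intro Henstock_Kurzweil_Integration.integral_combine) auto
    then have "upper_integral F x - upper_integral F y = integral {x..y} F"
      using xy by (simp add: upper_integral_eq[OF F] algebra_simps)
    also have "cmod \<dots> \<le> B * (y - x)"
    proof -
      have "(F has_integral integral {x..y} F) (cbox x y)"
        using set_lebesgue_integral_eq_integral(1)[OF darboux_integrable_on[OF F, of x y]] xy by auto
      from has_integral_bound[OF _ this, of B] show ?thesis
        using xy B by auto
    qed
    finally show ?thesis .
  qed
  show ?thesis
  proof (rule Lipschitz_darboux)
    fix x y :: real assume "x \<in> {0..1}" "y \<in> {0..1}"
    then show "cmod (upper_integral F x - upper_integral F y) \<le> B * \<bar>x - y\<bar>"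
      using le[of x y] le[of y x] norm_minus_commute[of "upper_integral F x"] by (cases "x \<le> y") auto
  qed
qed

text \<open>The error of a tail is at most the sum of the errors of its cells, hence at most the
  total over all cells, which the oscillation sum controls. This is why one \<open>N\<close> serves
  all \<open>j\<close>, including \<open>j = 0\<close>.\<close>

lemma tail_riemann_sum:
  assumes F: "F \<in> darboux" and e: "e > 0"
  shows "\<forall>\<^sub>F N in sequentially. \<forall>j\<le>N.
    cmod ((\<Sum>k\<in>{j<..N}. F (real k / real N)) / of_nat N - upper_integral F (real j / real N)) \<le> e"
proof -
  have "\<forall>\<^sub>F N in sequentially. \<forall>x y. (\<forall>k\<in>{1..N}. x k \<in> cell N k \<and> y k \<in> cell N k) \<longrightarrow>
     (\<Sum>k=1..N. cmod (F (x k) - F (y k))) \<le> e / 2 * real N"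
    by (rule darboux_osc[OF F]) (use e in simp)
  with eventually_ge_at_top[of 1] show ?thesis
  proof eventually_elim
    case (elim N)
    then have N: "real N > 0" by simp
    have int: "F integrable_on {a..b}" if "0 \<le> a" "b \<le> 1" for a b
      using set_lebesgue_integral_eq_integral(1)[OF darboux_integrable_on[OF F that]] .
    \<comment> \<open>A single tag \<open>y\<close> can witness the error of a cell: the supremum of
      the oscillation about \<open>k / N\<close> need not be attained, and the slack
      \<open>e / 2\<close> makes up for this.\<close>
    have ex: "\<exists>y\<in>cell N k. cmod (F (real k / real N) / of_nat N - integral (cell N k) F) \<le>
        (cmod (F (real k / real N) - F y) + e / 2) / real N" if k: "k \<in> {1..N}" for k
    proof (rule ccontr)
      \<comment> \<open>\<open>D\<close> solves \<open>error = (D + e / 2) / N\<close>. If no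
        \<open>y\<close> works, the oscillation about \<open>k / N\<close> is at most
        \<open>D\<close> on the whole cell; integrating bounds the error by \<open>D / N\<close>,
        which is less than the error.\<close>
      define D where "D = real N * cmod (F (real k / real N) / of_nat N - integral (cell N k) F) - e / 2"
      assume neg: "\<not> ?thesis"
      then have lt: "cmod (F (real k / real N) - F y) \<le> D" if "y \<in> cell N k" for y
      proof -
        have "(cmod (F (real k / real N) - F y) + e / 2) / real N
            < cmod (F (real k / real N) / of_nat N - integral (cell N k) F)"
          using neg that by (simp add: not_le)
        then show ?thesis
          using N unfolding D_def by (subst (asm) pos_divide_less_eq) (simp_all add: mult.commute)
      qed
      have D0: "D \<ge> 0"
        using lt[of "real k / real N"] by (auto simp: cell_def divide_right_mono)
      have c: "cell N k = cbox ((real k - 1) / real N) (real k / real N)" by (simp add: cell_def)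
      have le: "(real k - 1) / real N \<le> real k / real N" by (simp add: divide_right_mono)
      have "((\<lambda>y. F (real k / real N) - F y) has_integral
          (1 / real N) *\<^sub>R F (real k / real N) - integral (cell N k) F) (cell N k)"
      proof (rule has_integral_diff)
        show "((\<lambda>y. F (real k / real N)) has_integral (1 / real N) *\<^sub>R F (real k / real N)) (cell N k)"
          using has_integral_const[of "F (real k / real N)" "(real k - 1) / real N" "real k / real N"]
            cell_props(1)[OF k] unfolding c by simp
        show "(F has_integral integral (cell N k) F) (cell N k)"
          using int[of "(real k - 1) / real N" "real k / real N"] k N by (auto simp: cell_def)
      qed
      from has_integral_bound[OF D0 this[unfolded c]] lt cell_props(1)[OF k]
      have "cmod ((1 / real N) *\<^sub>R F (real k / real N) - integral (cell N k) F) \<le> D * (1 / real N)"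
        unfolding c by auto
      also have "(1 / real N) *\<^sub>R F (real k / real N) = F (real k / real N) / of_nat N"
        by (simp add: scaleR_conv_of_real)
      also have "D * (1 / real N) < cmod (F (real k / real N) / of_nat N - integral (cell N k) F)"
        using N e unfolding D_def by (simp add: field_simps)
      finally show False by simp
    qed
    then obtain y where y: "\<And>k. k \<in> {1..N} \<Longrightarrow> y k \<in> cell N k"
      "\<And>k. k \<in> {1..N} \<Longrightarrow> cmod (F (real k / real N) / of_nat N - integral (cell N k) F) \<le>
        (cmod (F (real k / real N) - F (y k)) + e / 2) / real N" by metis
    \<comment> \<open>Cells are closed, so the right endpoint \<open>k / N\<close>, the sampling
      point of \<open>S_op\<close>, is an admissible tag.\<close>
    have osc: "(\<Sum>k=1..N. cmod (F (real k / real N) - F (y k))) \<le> e / 2 * real N"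
      using elim(2)[rule_format, of "\<lambda>k. real k / real N" y] y(1)
      by (auto simp: cell_def divide_right_mono)
    have split: "integral {real j / real N..real n / real N} F = (\<Sum>k\<in>{j<..n}. integral (cell N k) F)"
      if "j \<le> n" "n \<le> N" for j n
      using that
    proof (induction n rule: dec_induct)
      case (step n)
      have "integral {real j / real N..real n / real N} F + integral {real n / real N..real (Suc n) / real N} F
          = integral {real j / real N..real (Suc n) / real N} F"
        using step N by (intro Henstock_Kurzweil_Integration.integral_combine int)
          (auto simp: divide_right_mono simp del: of_nat_Suc)
      moreover have "{j<..Suc n} = insert (Suc n) {j<..n}" using step by auto
      ultimately show ?case using step by (simp add: cell_def add.commute)
    qed simp
    show ?case
    proof (intro allI impI)
      fix j assume j: "j \<le> N"
      have "upper_integral F (real j / real N) = (\<Sum>k\<in>{j<..N}. integral (cell N k) F)"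
        using split[OF j order_refl] j N by (simp add: upper_integral_eq[OF F])
      then have "cmod ((\<Sum>k\<in>{j<..N}. F (real k / real N)) / of_nat N - upper_integral F (real j / real N))
          = cmod (\<Sum>k\<in>{j<..N}. F (real k / real N) / of_nat N - integral (cell N k) F)"
        by (simp add: sum_subtractf sum_divide_distrib)
      also have "\<dots> \<le> (\<Sum>k\<in>{j<..N}. (cmod (F (real k / real N) - F (y k)) + e / 2) / real N)"
        by (rule sum_norm_le) (use y(2) in auto)
      \<comment> \<open>The summands are nonnegative, so the tail may be extended to all cells; from
        here on the bound does not depend on \<open>j\<close>.\<close>
      also have "\<dots> \<le> (\<Sum>k=1..N. (cmod (F (real k / real N) - F (y k)) + e / 2) / real N)"
        using e by (intro sum_mono2) auto
      also have "\<dots> = ((\<Sum>k=1..N. cmod (F (real k / real N) - F (y k))) + real N * (e / 2)) / real N"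
        by (simp add: sum_divide_distrib[symmetric] sum.distrib)
      also have "\<dots> \<le> e" using osc N by (simp add: field_simps)
      finally show "cmod ((\<Sum>k\<in>{j<..N}. F (real k / real N)) / of_nat N - upper_integral F (real j / real N)) \<le> e" .
    qed
  qed
qed

section \<open>Uniform approximation at the grid points\<close>

text \<open>After an annihilation the coefficients of the discrete vector are no longer exact
  samples of a function, only uniformly close to them. Membership in \<open>darboux\<close> is
  included so that regularity travels along with closeness.\<close>

definition approximates :: "(nat \<Rightarrow> nat \<Rightarrow> complex) \<Rightarrow> (real \<Rightarrow> complex) \<Rightarrow> bool" where
  "approximates u g \<longleftrightarrow> g \<in> darboux \<and>
     (\<forall>e>0. \<forall>\<^sub>F N in sequentially. \<forall>k\<in>{1..N}. cmod (u N k - g (real k / real N)) \<le> e)"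

lemma approximates_sample: "f \<in> darboux \<Longrightarrow> approximates (\<lambda>N k. f (real k / real N)) f"
  by (simp add: approximates_def)

lemma approximates_mult:
  assumes u: "approximates u f" and v: "approximates v g"
  shows "approximates (\<lambda>N k. u N k * v N k) (\<lambda>x. f x * g x)"
proof -
  have f: "f \<in> darboux" and g: "g \<in> darboux" using u v by (simp_all add: approximates_def)
  obtain A where A: "A > 0" "\<And>x. x \<in> {0..1} \<Longrightarrow> cmod (f x) \<le> A" using darboux_bound[OF f] by blast
  obtain B where B: "B > 0" "\<And>x. x \<in> {0..1} \<Longrightarrow> cmod (g x) \<le> B" using darboux_bound[OF g] by blast
  have "\<forall>\<^sub>F N in sequentially. \<forall>k\<in>{1..N}.
      cmod (u N k * v N k - f (real k / real N) * g (real k / real N)) \<le> e" if e: "e > 0" for e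
  proof -
    \<comment> \<open>The bound 1 gives \<open>cmod (v N k) \<le> B + 1\<close>; the other bound
      makes the resulting total error \<open>d * (B + 1) + A * d\<close> at most
      \<open>e\<close>.\<close>
    define d where "d = min 1 (e / (A + B + 1))"
    have d: "d > 0" "d \<le> 1" using e A B by (auto simp: d_def)
    have "d \<le> e / (A + B + 1)" by (simp add: d_def)
    then have "d * (A + B + 1) \<le> e"
      using A(1) B(1) by (subst (asm) pos_le_divide_eq) simp_all
    then have de: "d * (B + 1) + A * d \<le> e" by (simp add: algebra_simps)
    have "\<forall>\<^sub>F N in sequentially. \<forall>k\<in>{1..N}. cmod (u N k - f (real k / real N)) \<le> d"
      "\<forall>\<^sub>F N in sequentially. \<forall>k\<in>{1..N}. cmod (v N k - g (real k / real N)) \<le> d"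
      using u v d(1) unfolding approximates_def by blast+
    then show ?thesis
    proof eventually_elim
      case (elim N)
      show ?case
      proof
        fix k assume k: "k \<in> {1..N}"
        define x where "x = real k / real N"
        have x: "x \<in> {0..1}" using k by (simp add: x_def)
        have uf: "cmod (u N k - f x) \<le> d" and vg: "cmod (v N k - g x) \<le> d"
          using elim k by (auto simp: x_def)
        have "cmod (v N k) \<le> cmod (g x) + cmod (v N k - g x)" by (rule norm_triangle_sub)
        then have "cmod (v N k) \<le> B + 1" using vg d B(2)[OF x] by linarith
        then have "cmod (u N k - f x) * cmod (v N k) + cmod (f x) * cmod (v N k - g x) \<le>
            d * (B + 1) + A * d"
          using uf vg A(1) A(2)[OF x] d by (intro add_mono mult_mono) auto
        moreover have "u N k * v N k - f x * g x = (u N k - f x) * v N k + f x * (v N k - g x)"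
          by (simp add: algebra_simps)
        then have "cmod (u N k * v N k - f x * g x) \<le>
            cmod (u N k - f x) * cmod (v N k) + cmod (f x) * cmod (v N k - g x)"
          by (metis norm_mult norm_triangle_ineq)
        ultimately show "cmod (u N k * v N k - f (real k / real N) * g (real k / real N)) \<le> e"
          using de unfolding x_def by linarith
      qed
    qed
  qed
  then show ?thesis
    using darboux_mult[OF f g] by (simp add: approximates_def)
qed

text \<open>At most \<open>N\<close> terms are averaged with weight \<open>1 / N\<close>, so
  exchanging \<open>F\<close> for \<open>u\<close> costs no more than the uniform error. The value
  \<open>j = 0\<close> yields the full sum left by the last particle, \<open>j \<ge> 1\<close> the
  coefficient multiplied into the next factor.\<close>

lemma approximates_tail_sum:
  assumes u: "approximates u F" and e: "e > 0"
  shows "\<forall>\<^sub>F N in sequentially. \<forall>j\<le>N.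
    cmod ((\<Sum>k\<in>{j<..N}. u N k) / of_nat N - upper_integral F (real j / real N)) \<le> e"
proof -
  have F: "F \<in> darboux" and
    "\<forall>\<^sub>F N in sequentially. \<forall>k\<in>{1..N}. cmod (u N k - F (real k / real N)) \<le> e / 2"
    using u half_gt_zero[OF e] unfolding approximates_def by blast+
  note this(2)
  moreover have "\<forall>\<^sub>F N in sequentially. \<forall>j\<le>N.
    cmod ((\<Sum>k\<in>{j<..N}. F (real k / real N)) / of_nat N - upper_integral F (real j / real N)) \<le> e / 2"
    using e by (intro tail_riemann_sum F) simp
  ultimately show ?thesis
    using eventually_ge_at_top[of 1]
  proof eventually_elim
    case (elim N)
    show ?case
    proof (intro allI impI)
      fix j assume j: "j \<le> N"
      let ?U = "(\<Sum>k\<in>{j<..N}. u N k) / of_nat N"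
      let ?F = "(\<Sum>k\<in>{j<..N}. F (real k / real N)) / of_nat N"
      have "cmod (\<Sum>k\<in>{j<..N}. u N k - F (real k / real N)) \<le> of_nat (card {j<..N}) * (e / 2)"
        by (rule sum_norm_bound) (use elim in auto)
      also have "\<dots> \<le> real N * (e / 2)"
        using e by (intro mult_right_mono) auto
      finally have "cmod (?U - ?F) \<le> e / 2"
        using elim(3) by (simp add: sum_subtractf diff_divide_distrib[symmetric] norm_divide divide_le_eq mult.commute)
      moreover have "cmod (?F - upper_integral F (real j / real N)) \<le> e / 2"
        using elim(2) j by blast
      ultimately show "cmod (?U - upper_integral F (real j / real N)) \<le> e"
        using norm_triangle_ineq[of "?U - ?F" "?F - upper_integral F (real j / real N)"] by simp
    qed
  qed
qed

lemma approximates_upper_integral: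
  assumes "approximates u F"
  shows "approximates (\<lambda>N j. (\<Sum>k\<in>{j<..N}. u N k) / of_nat N) (upper_integral F)"
  unfolding approximates_def
proof (intro conjI allI impI)
  show "upper_integral F \<in> darboux"
    using assms by (intro upper_integral_darboux) (simp add: approximates_def)
  fix e :: real assume "e > 0"
  from approximates_tail_sum[OF assms this]
  show "\<forall>\<^sub>F N in sequentially. \<forall>j\<in>{1..N}.
      cmod ((\<Sum>k\<in>{j<..N}. u N k) / of_nat N - upper_integral F (real j / real N)) \<le> e"
    by eventually_elim simp
qed

lemma approximates_full_sum:
  assumes "approximates u F"
  shows "(\<lambda>N. (\<Sum>k\<in>{0<..N}. u N k) / of_nat N) \<longlonglongrightarrow> (LINT s|lebesgue_on {0..1}. F s)"
proof (rule tendstoI)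
  have F: "F \<in> darboux" using assms by (simp add: approximates_def)
  fix e :: real assume "e > 0"
  then have "e / 2 > 0" by simp
  from approximates_tail_sum[OF assms this]
  show "\<forall>\<^sub>F N in sequentially.
      dist ((\<Sum>k\<in>{0<..N}. u N k) / of_nat N) (LINT s|lebesgue_on {0..1}. F s) < e"
  proof eventually_elim
    case (elim N)
    from elim[rule_format, of 0] \<open>e > 0\<close> show ?case
      by (simp add: dist_norm lebesgue_integral_eq_upper[OF F])
  qed
qed

section \<open>Elementary tensors in the two Fock spaces\<close>

text \<open>The value 0 on lists of different lengths confines a tensor to a single particle
  number.\<close>

fun tensor :: "('a \<Rightarrow> complex) list \<Rightarrow> 'a list \<Rightarrow> complex" where
  "tensor [] [] = 1"
| "tensor (g # gs) (x # xs) = g x * tensor gs xs"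
| "tensor _ _ = 0"

text \<open>No cutoff to decreasing tuples appears, because \<open>simplex_measure\<close> lives on
  them.\<close>

definition c_tensor :: "complex \<Rightarrow> (real \<Rightarrow> complex) list \<Rightarrow> cvec" where
  "c_tensor c gs = (\<lambda>n t. c * tensor gs (map t [0..<n]))"

text \<open>Entries are confined to \<open>{1..N}\<close>, the indices used by \<open>S_op\<close>.
  Each factor carries one \<open>1 / sqrt N\<close>: creation supplies it, and annihilation combines
  it with its own to form the weight \<open>1 / N\<close> of a Riemann sum.\<close>

definition d_tensor :: "nat \<Rightarrow> complex \<Rightarrow> (nat \<Rightarrow> complex) list \<Rightarrow> dvec" where
  "d_tensor N c us = (\<lambda>\<alpha>. if \<alpha> \<in> dseqs \<and> set \<alpha> \<subseteq> {1..N}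
     then c * tensor us \<alpha> / complex_of_real (sqrt (real N)) ^ length us else 0)"

section \<open>Creation and annihilation of tensors in the continuous space\<close>

lemma c_vacuum_tensor: "c_vacuum = c_tensor 1 []"
proof (intro ext)
  fix n t show "c_vacuum n t = c_tensor 1 [] n t"
    by (cases n) (simp_all add: c_vacuum_def c_tensor_def upt_conv_Cons del: upt_Suc)
qed

lemma map_upt_Suc: "map t [0..<Suc k] = t 0 # map (\<lambda>i. t (Suc i)) [0..<k]"
  by (simp add: upt_conv_Cons map_Suc_upt[symmetric] comp_def del: upt_Suc)

lemma c_create_tensor: "c_create f (c_tensor c gs) = c_tensor c (f # gs)"
proof (intro ext)
  fix n t
  have "map (tup_tail k t) [0..<k] = map (\<lambda>i. t (Suc i)) [0..<k]" for k
    by (auto simp: tup_tail_def)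
  then show "c_create f (c_tensor c gs) n t = c_tensor c (f # gs) n t"
    by (cases n) (simp_all only: nat.case c_create_def c_tensor_def map_upt_Suc tensor.simps upt_0 list.map mult_zero_right mult.left_commute)
qed

lemma c_annih_tensor:
  "c_annih f (c_tensor c (g # gs)) n t =
     (LINT s|lebesgue_on {s \<in> {0..1}. n \<ge> 1 \<longrightarrow> s > t 0}. cnj (f s) * g s) * c_tensor c gs n t"
proof -
  have "map (tup_cons n s t) [0..<Suc n] = s # map t [0..<n]" for s
    unfolding map_upt_Suc by (simp add: tup_cons_def)
  then have "cnj (f s) * c_tensor c (g # gs) (Suc n) (tup_cons n s t) =
      (cnj (f s) * g s) * c_tensor c gs n t" for s
    by (simp add: c_tensor_def del: upt_Suc)
  then show ?thesis
    unfolding c_annih_def by (simp only: Bochner_Integration.integral_mult_left_zero)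
qed

text \<open>The zero vector is recorded as a tensor with scalar 0, which keeps all words within
  tensors.\<close>

lemma c_annih_tensor_Nil: "c_annih f (c_tensor c []) = c_tensor 0 []"
  by (simp add: fun_eq_iff c_annih_def c_tensor_def map_upt_Suc del: upt_Suc)

lemma c_annih_tensor_single:
  "c_annih f (c_tensor c [g]) = c_tensor (c * (LINT s|lebesgue_on {0..1}. cnj (f s) * g s)) []"
proof (intro ext)
  fix n t show "c_annih f (c_tensor c [g]) n t =
      c_tensor (c * (LINT s|lebesgue_on {0..1}. cnj (f s) * g s)) [] n t"
    unfolding c_annih_tensor
    \<comment> \<open>For \<open>n > 0\<close> both sides vanish, since no factor is left for the
      coordinates; for \<open>n = 0\<close> the integral runs over the whole unit interval.\<close>
    by (cases n) (simp_all add: c_tensor_def map_upt_Suc del: upt_Suc atLeastAtMost_iff)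
qed

text \<open>The integral depends on the remaining coordinates through \<open>t 0\<close> alone,
  which is the argument of \<open>h\<close>, so it can be absorbed into that factor.\<close>

lemma c_annih_tensor_Cons:
  "c_annih f (c_tensor c (g # h # gs)) =
     c_tensor c ((\<lambda>x. h x * upper_integral (\<lambda>s. cnj (f s) * g s) x) # gs)"
proof (intro ext)
  fix n t show "c_annih f (c_tensor c (g # h # gs)) n t =
      c_tensor c ((\<lambda>x. h x * upper_integral (\<lambda>s. cnj (f s) * g s) x) # gs) n t"
    unfolding c_annih_tensor
    by (cases n) (simp_all add: c_tensor_def map_upt_Suc upper_integral_def del: upt_Suc)
qed

lemma c_inner_vacuum_tensor: "c_inner c_vacuum (c_tensor c gs) = (if gs = [] then c else 0)"
proof -
  \<comment> \<open>The product over no coordinates is the unit mass at the only extensional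
    function.\<close>
  have "simplex_measure 0 = count_space {\<lambda>_. undefined}"
    by (simp add: simplex_measure_def PiM_empty restrict_count_space)
  moreover have "c_tensor c gs 0 t = (if gs = [] then c else 0)" for t
    by (cases gs) (simp_all add: c_tensor_def)
  ultimately have "(LINT t|simplex_measure 0. cnj (c_vacuum 0 t) * c_tensor c gs 0 t) = (if gs = [] then c else 0)"
    by (simp add: c_vacuum_def lebesgue_integral_count_space_finite)
  then show ?thesis
    unfolding c_inner_def
    by (subst suminf_finite[of "{0}"]) (auto simp: c_vacuum_def)
qed

section \<open>Creation and annihilation of tensors in the discrete space\<close>

lemma d_vacuum_tensor: "d_vacuum = d_tensor N 1 []"
proof
  fix \<alpha> show "d_vacuum \<alpha> = d_tensor N 1 [] \<alpha>"
    by (cases \<alpha>) (simp_all add: d_vacuum_def d_basis_def d_tensor_def dseqs_def)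
qed

lemma S_op_create_tensor:
  "S_op N 1 f (d_tensor N c us) = d_tensor N c ((\<lambda>k. f (real k / real N)) # us)"
proof
  fix \<alpha>
  show "S_op N 1 f (d_tensor N c us) \<alpha> = d_tensor N c ((\<lambda>k. f (real k / real N)) # us) \<alpha>"
  proof (cases \<alpha>)
    case Nil
    then show ?thesis by (simp add: S_op_def d_create_def d_tensor_def)
  next
    case (Cons j \<beta>)
    \<comment> \<open>Only the operator whose index is the head of the sequence contributes.\<close>
    have "(\<Sum>k=1..N. f (real k / real N) * d_create k (d_tensor N c us) \<alpha>) =
        (\<Sum>k=1..N. if j = k then f (real j / real N) * d_create j (d_tensor N c us) \<alpha> else 0)"
      by (rule sum.cong) (auto simp: d_create_def Cons)
    also have "\<dots> = (if j \<in> {1..N} then f (real j / real N) * d_create j (d_tensor N c us) \<alpha> else 0)"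
      by simp
    finally have "S_op N 1 f (d_tensor N c us) \<alpha> =
        (if j \<in> {1..N} then f (real j / real N) * d_create j (d_tensor N c us) \<alpha> else 0) /
          complex_of_real (sqrt (real N))"
      by (simp add: S_op_def)
    then show ?thesis
      by (auto simp: d_create_def d_tensor_def Cons dseqs_def mult.commute mult.left_commute)
  qed
qed

lemma S_op_annih_tensor_Nil: "S_op N (- 1) f (d_tensor N c []) = d_tensor N 0 []"
proof -
  have "d_annih k (d_tensor N c []) \<alpha> = 0" for k \<alpha>
    by (simp add: d_annih_def d_tensor_def)
  then show ?thesis
    by (simp add: fun_eq_iff S_op_def d_tensor_def)
qed

lemma S_op_annih_tensor:
  "S_op N (- 1) f (d_tensor N c (u # us)) \<alpha> =
     (\<Sum>k\<in>{(if \<alpha> = [] then 0 else hd \<alpha>)<..N}. cnj (f (real k / real N)) * u k) / of_nat N * d_tensor N c us \<alpha>"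
proof -
  \<comment> \<open>On the empty sequence every index is allowed; the default 0 expresses this
    because indices start at 1.\<close>
  let ?h = "if \<alpha> = [] then 0 else hd \<alpha>"
  let ?r = "complex_of_real (sqrt (real N))"
  have r: "?r * ?r = of_nat N"
    by (simp flip: of_real_mult)
  have "k # \<alpha> \<in> dseqs \<longleftrightarrow> \<alpha> \<in> dseqs \<and> k > ?h" if "k \<ge> 1" for k
    using that by (cases \<alpha>) (auto simp: dseqs_def)
  then have summand: "cnj (f (real k / real N)) * d_annih k (d_tensor N c (u # us)) \<alpha> =
      (if k > ?h then (cnj (f (real k / real N)) * u k) * (d_tensor N c us \<alpha> / ?r) else 0)"
    if "k \<in> {1..N}" for k
    using that by (auto simp: d_annih_def d_tensor_def mult_ac)
  have "(\<Sum>k=1..N. cnj (f (real k / real N)) * d_annih k (d_tensor N c (u # us)) \<alpha>) =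
      (\<Sum>k=1..N. if k > ?h then (cnj (f (real k / real N)) * u k) * (d_tensor N c us \<alpha> / ?r) else 0)"
    by (rule sum.cong[OF refl summand])
  also have "\<dots> = (\<Sum>k\<in>{?h<..N}. (cnj (f (real k / real N)) * u k) * (d_tensor N c us \<alpha> / ?r))"
    by (rule sum.mono_neutral_cong_right) auto
  also have "\<dots> = (\<Sum>k\<in>{?h<..N}. cnj (f (real k / real N)) * u k) * (d_tensor N c us \<alpha> / ?r)"
    by (simp only: sum_distrib_right)
  finally show ?thesis
    by (simp add: S_op_def flip: r)
qed

lemma S_op_annih_tensor_single:
  "S_op N (- 1) f (d_tensor N c [u]) =
     d_tensor N (c * ((\<Sum>k\<in>{0<..N}. cnj (f (real k / real N)) * u k) / of_nat N)) []"
proof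
  fix \<alpha> show "S_op N (- 1) f (d_tensor N c [u]) \<alpha> =
     d_tensor N (c * ((\<Sum>k\<in>{0<..N}. cnj (f (real k / real N)) * u k) / of_nat N)) [] \<alpha>"
    unfolding S_op_annih_tensor by (cases \<alpha>) (simp_all add: d_tensor_def)
qed

text \<open>As in \<open>c_annih_tensor_Cons\<close>, the tail sum depends only on the head of the
  remaining sequence, at which \<open>v\<close> is evaluated.\<close>

lemma S_op_annih_tensor_Cons:
  "S_op N (- 1) f (d_tensor N c (u # v # us)) =
     d_tensor N c ((\<lambda>j. v j * ((\<Sum>k\<in>{j<..N}. cnj (f (real k / real N)) * u k) / of_nat N)) # us)"
proof
  fix \<alpha> show "S_op N (- 1) f (d_tensor N c (u # v # us)) \<alpha> =
     d_tensor N c ((\<lambda>j. v j * ((\<Sum>k\<in>{j<..N}. cnj (f (real k / real N)) * u k) / of_nat N)) # us) \<alpha>"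
    unfolding S_op_annih_tensor by (cases \<alpha>) (simp_all add: d_tensor_def mult_ac)
qed

lemma d_inner_vacuum_tensor: "d_inner d_vacuum (d_tensor N c us) = (if us = [] then c else 0)"
proof -
  have "d_inner d_vacuum (d_tensor N c us) = (\<Sum>\<^sub>\<infinity>\<alpha>\<in>{[]}. cnj (d_vacuum \<alpha>) * d_tensor N c us \<alpha>)"
    unfolding d_inner_def
    by (rule infsum_cong_neutral) (auto simp: d_vacuum_def d_basis_def dseqs_def)
  then show ?thesis
    by (cases us) (simp_all add: d_vacuum_def d_basis_def d_tensor_def dseqs_def)
qed

section \<open>Words of operators applied to the vacuum\<close>

lemma foldr_comp_Cons_apply:
  "foldr (\<lambda>j X. A j \<circ> X) (j # js) id v = A j (foldr (\<lambda>j X. A j \<circ> X) js id v)"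
  by simp

text \<open>The rightmost operator acts first, so induction on the list adds operators on the left.
  Each changes the number of factors by one, which preserves the parity clause; the alternative
  \<open>c = 0\<close> covers words that annihilate the vacuum on the way.\<close>

lemma word_on_vacuum:
  assumes "\<And>j. j \<in> set js \<Longrightarrow> \<epsilon> j \<in> {-1, 1}" and "\<And>j. j \<in> set js \<Longrightarrow> f j \<in> darboux"
  shows "\<exists>c gs cs us.
    foldr (\<lambda>j X. b_op (\<epsilon> j) (f j) \<circ> X) js id c_vacuum = c_tensor c gs \<and>
    (\<forall>N. foldr (\<lambda>j X. S_op N (\<epsilon> j) (f j) \<circ> X) js id d_vacuum =
      d_tensor N (cs N) (map (\<lambda>u. u N) us)) \<and>
    cs \<longlonglongrightarrow> c \<and> list_all2 approximates us gs \<and> (c = 0 \<or> even (length gs + length js))"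
  using assms
proof (induction js)
  case Nil
  show ?case
    by (rule exI[of _ 1], rule exI[of _ "[]"], rule exI[of _ "\<lambda>_. 1"], rule exI[of _ "[]"])
       (simp add: c_vacuum_tensor flip: d_vacuum_tensor)
next
  case (Cons j js)
  have "\<exists>c gs cs us.
    foldr (\<lambda>j X. b_op (\<epsilon> j) (f j) \<circ> X) js id c_vacuum = c_tensor c gs \<and>
    (\<forall>N. foldr (\<lambda>j X. S_op N (\<epsilon> j) (f j) \<circ> X) js id d_vacuum =
      d_tensor N (cs N) (map (\<lambda>u. u N) us)) \<and>
    cs \<longlonglongrightarrow> c \<and> list_all2 approximates us gs \<and> (c = 0 \<or> even (length gs + length js))"
    by (rule Cons.IH) (use Cons.prems in simp_all)
  then obtain c gs cs us where
    C: "foldr (\<lambda>j X. b_op (\<epsilon> j) (f j) \<circ> X) js id c_vacuum = c_tensor c gs" and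
    D: "\<And>N. foldr (\<lambda>j X. S_op N (\<epsilon> j) (f j) \<circ> X) js id d_vacuum = d_tensor N (cs N) (map (\<lambda>u. u N) us)" and
    lim: "cs \<longlonglongrightarrow> c" and app: "list_all2 approximates us gs" and
    par: "c = 0 \<or> even (length gs + length js)"
    by blast
  have f: "f j \<in> darboux" and \<epsilon>: "\<epsilon> j = 1 \<or> \<epsilon> j = - 1" using Cons.prems[of j] by auto
  \<comment> \<open>It remains to exhibit the tensor data after one more operator.\<close>
  have step: ?case
    if "b_op (\<epsilon> j) (f j) (c_tensor c gs) = c_tensor c' gs'"
      "\<And>N. S_op N (\<epsilon> j) (f j) (d_tensor N (cs N) (map (\<lambda>u. u N) us)) =
         d_tensor N (cs' N) (map (\<lambda>u. u N) us')"
      "cs' \<longlonglongrightarrow> c'" "list_all2 approximates us' gs'" "c' = 0 \<or> even (length gs' + length (j # js))"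
    for c' gs' cs' us'
    unfolding foldr_comp_Cons_apply C D using that by blast
  from \<epsilon> show ?case
  proof
    assume e: "\<epsilon> j = 1"
    show ?thesis
      by (rule step[of c "f j # gs" cs "(\<lambda>N k. f j (real k / real N)) # us"])
         (use e lim app par f in \<open>auto simp: b_op_def c_create_tensor S_op_create_tensor approximates_sample\<close>)
  next
    assume e: "\<epsilon> j = - 1"
    then have b: "b_op (\<epsilon> j) = c_annih" by (simp add: b_op_def fun_eq_iff)
    have pair: "approximates (\<lambda>N k. cnj (f j (real k / real N)) * u N k) (\<lambda>s. cnj (f j s) * g s)"
      if "approximates u g" for u g
      by (rule approximates_mult[OF approximates_sample[OF darboux_cnj[OF f]] that])
    \<comment> \<open>Annihilation kills the vacuum, turns a single factor into a scalar, and
      otherwise modifies the second factor.\<close>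
    consider "us = []" "gs = []"
      | u g where "us = [u]" "gs = [g]" "approximates u g"
      | u v us' g h gs' where "us = u # v # us'" "gs = g # h # gs'"
          "approximates u g" "approximates v h" "list_all2 approximates us' gs'"
    proof (cases us)
      case Nil
      then show ?thesis using that(1) app by simp
    next
      case (Cons u us1)
      then obtain g gs1 where gs: "gs = g # gs1" "approximates u g" "list_all2 approximates us1 gs1"
        using app by (auto simp: list_all2_Cons1)
      show ?thesis
      proof (cases us1)
        case Nil
        then show ?thesis using that(2) Cons gs by simp
      next
        case (Cons v us')
        then show ?thesis using that(3) \<open>us = u # us1\<close> gs by (auto simp: list_all2_Cons1)
      qed
    qed
    then show ?thesis
    proof cases
      case 1
      show ?thesis
        \<comment> \<open>The number of factors stays 0, so parity fails and the clause is met by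
          the scalar 0.\<close>
        by (rule step[of 0 "[]" "\<lambda>_. 0" "[]"])
           (simp_all add: b_op_def e 1 c_annih_tensor_Nil S_op_annih_tensor_Nil)
    next
      case (2 u g)
      show ?thesis
      proof (rule step)
        show "b_op (\<epsilon> j) (f j) (c_tensor c gs) =
            c_tensor (c * (LINT s|lebesgue_on {0..1}. cnj (f j s) * g s)) []"
          by (simp add: b 2 c_annih_tensor_single)
        show "S_op N (\<epsilon> j) (f j) (d_tensor N (cs N) (map (\<lambda>u. u N) us)) =
            d_tensor N (cs N * ((\<Sum>k\<in>{0<..N}. cnj (f j (real k / real N)) * u N k) / of_nat N))
              (map (\<lambda>u. u N) [])" for N
          by (simp add: e 2 S_op_annih_tensor_single)
        show "(\<lambda>N. cs N * ((\<Sum>k\<in>{0<..N}. cnj (f j (real k / real N)) * u N k) / of_nat N))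
            \<longlonglongrightarrow> c * (LINT s|lebesgue_on {0..1}. cnj (f j s) * g s)"
          by (intro tendsto_mult lim approximates_full_sum pair 2)
      qed (use par 2 in auto)
    next
      case (3 u v us' g h gs')
      show ?thesis
      proof (rule step)
        show "b_op (\<epsilon> j) (f j) (c_tensor c gs) =
            c_tensor c ((\<lambda>x. h x * upper_integral (\<lambda>s. cnj (f j s) * g s) x) # gs')"
          by (simp add: b 3 c_annih_tensor_Cons)
        show "S_op N (\<epsilon> j) (f j) (d_tensor N (cs N) (map (\<lambda>u. u N) us)) =
            d_tensor N (cs N) (map (\<lambda>u. u N)
              ((\<lambda>N i. v N i * ((\<Sum>k\<in>{i<..N}. cnj (f j (real k / real N)) * u N k) / of_nat N)) # us'))" for N
          by (simp add: e 3 S_op_annih_tensor_Cons)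
        show "list_all2 approximates
            ((\<lambda>N i. v N i * ((\<Sum>k\<in>{i<..N}. cnj (f j (real k / real N)) * u N k) / of_nat N)) # us')
            ((\<lambda>x. h x * upper_integral (\<lambda>s. cnj (f j s) * g s) x) # gs')"
          unfolding list_all2_Cons
          using approximates_mult[OF 3(4) approximates_upper_integral[OF pair[OF 3(3)]]] 3(5) by (rule conjI)
      qed (use par lim 3 in auto)
    qed
  qed
qed

theorem theorem4p5:
  fixes m :: nat and \<epsilon> :: "nat \<Rightarrow> int" and f :: "nat \<Rightarrow> real \<Rightarrow> complex"
  assumes "m \<ge> 1"
    and "\<And>j. j \<in> {1..m} \<Longrightarrow> \<epsilon> j \<in> {-1, 1}"
    and "\<And>j. j \<in> {1..m} \<Longrightarrow> f j \<in> riemann_bounded_01"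
  shows "\<exists>L. (\<lambda>N. d_state (op_prod (\<lambda>j. S_op N (\<epsilon> j) (f j)) m)) \<longlonglongrightarrow> L
           \<and> (odd m \<longrightarrow> L = 0)
           \<and> (\<forall>n. m = 2 * n \<longrightarrow> L = c_state (op_prod (\<lambda>j. b_op (\<epsilon> j) (f j)) (2 * n)))"
proof -
  have "\<And>j. j \<in> set [1..<Suc m] \<Longrightarrow> \<epsilon> j \<in> {-1, 1}" "\<And>j. j \<in> set [1..<Suc m] \<Longrightarrow> f j \<in> darboux"
    using assms(2,3) riemann_bounded_darboux by (auto simp del: upt_Suc)
  then obtain c gs cs us where
    C: "foldr (\<lambda>j X. b_op (\<epsilon> j) (f j) \<circ> X) [1..<Suc m] id c_vacuum = c_tensor c gs" and
    D: "\<And>N. foldr (\<lambda>j X. S_op N (\<epsilon> j) (f j) \<circ> X) [1..<Suc m] id d_vacuum = d_tensor N (cs N) (map (\<lambda>u. u N) us)" and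
    lim: "cs \<longlonglongrightarrow> c" and app: "list_all2 approximates us gs" and
    par: "c = 0 \<or> even (length gs + length [1..<Suc m])"
    using word_on_vacuum[of "[1..<Suc m]" \<epsilon> f] by blast
  have cs: "c_state (op_prod (\<lambda>j. b_op (\<epsilon> j) (f j)) m) = (if gs = [] then c else 0)"
    unfolding c_state_def op_prod_def C by (rule c_inner_vacuum_tensor)
  have "us = [] \<longleftrightarrow> gs = []" using app by auto
  then have "(\<lambda>N. d_state (op_prod (\<lambda>j. S_op N (\<epsilon> j) (f j)) m)) \<longlonglongrightarrow> (if gs = [] then c else 0)"
    unfolding d_state_def op_prod_def D using lim by (simp add: d_inner_vacuum_tensor)
  \<comment> \<open>If no factor is left, the parity clause forces \<open>m\<close> to be even or
    \<open>c\<close> to be 0.\<close>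
  moreover have "odd m \<longrightarrow> (if gs = [] then c else 0) = 0"
    using par by (cases "gs = []"; cases "odd m") (simp_all del: upt_Suc)
  moreover have "\<forall>n. m = 2 * n \<longrightarrow>
      (if gs = [] then c else 0) = c_state (op_prod (\<lambda>j. b_op (\<epsilon> j) (f j)) (2 * n))"
    using cs[symmetric] by (intro allI impI) (simp only:)
  ultimately show ?thesis by (intro exI conjI)
qed

end
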